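(* Let $\mathcal G=(G_n,\|\cdot\|'_n)_{n\in\mathbb N}$ be a family of metric groups, let $(H,\|\cdot\|)$ be a metric group, and fix a non-principal ultrafilter $\mathcal U$ on $\mathbb N$. Suppose that $\mathcal G^*_{\mathrm{met,fin}}$ is a simple group (respectively, boundedly simple). Assume that the following holds: for every $t>0$, every $\varepsilon>0$ and all $h_1,h_2\in H$ with $\|h_1\|,\|h_2\|\le t$ there are $\mathcal U$-many $n\in\mathbb N$ for which there exist $g_1,g_2\in G_n$ and an isometric homomorphism $\phi_n\colon G_n\to H$ (i.e. $\|\phi_n(g)\|=\|g\|'_n$ for all $g\in G_n$) satisfying $\|\phi_n(g_i)h_i^{-1}\|<\varepsilon$ for $i=1,2$. Then the finitary metric ultrapower $H^*_{\mathrm{met,fin}}$ with respect to $\mathcal U$ is a simple group (respectively, boundedly simple).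
   Context: A metric group $(G,\|\cdot\|)$ is a group with a bi-invariant norm $\|\cdot\|\colon G\to[0,\infty]$: $\|e\|=0$, $\|gh\|\le\|g\|+\|h\|$, $\|g^{-1}\|=\|g\|=\|hgh^{-1}\|$, and $\|g\|=0$ iff $g=e$. The metric ultraproduct of a family $\mathcal G=(G_n,\|\cdot\|_n)_{n}$ is $\mathcal G^*_{\mathrm{met}}=\prod_{n}G_n/\mathcal E$, $\mathcal E=\{(g_n) : \lim_{n\to\mathcal U}\|g_n\|_n=0\}$, with norm $\|(g_n)/\mathcal E\|=\lim_{n\to\mathcal U}\|g_n\|_n\in[0,\infty]$; its finitary subgroup is $\mathcal G^*_{\mathrm{met,fin}}=\{x : \|x\|<\infty\}$. $H^*_{\mathrm{met,fin}}$ is this construction for the constant family $(H,\|\cdot\|)$. "For $\mathcal U$-many $n$" means for a set of $n$ belonging to $\mathcal U$. A group $G$ is boundedly simple if for every $g\in G\setminus\{e\}$ there is $N\in\mathbb N$ such that every element of $G$ is a product of at most $N$ conjugates of $g$ and $g^{-1}$. *)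

theory Defs
  imports "HOL-Analysis.Analysis" "HOL-Algebra.Coset" "HOL-Algebra.Product_Groups"
begin

definition ultrafilter :: "'i filter \<Rightarrow> bool"
  where "ultrafilter \<U> \<longleftrightarrow>
    \<U> \<noteq> bot \<and> (\<forall>P. eventually P \<U> \<or> eventually (\<lambda>i. \<not> P i) \<U>)"

definition nonprincipal_ultrafilter :: "'i filter \<Rightarrow> bool"
  where "nonprincipal_ultrafilter \<U> \<longleftrightarrow> ultrafilter \<U> \<and> (\<forall>i. \<U> \<noteq> principal {i})"

(* The norm is only constrained on the carrier; the value \<infinity> is allowed. *)
locale metric_group = group G for G (structure) +
  fixes nrm :: "'a \<Rightarrow> ennreal"
  assumes nrm_mult_le: "\<lbrakk>g \<in> carrier G; h \<in> carrier G\<rbrakk> \<Longrightarrow> nrm (g \<otimes> h) \<le> nrm g + nrm h"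
    and nrm_inv: "g \<in> carrier G \<Longrightarrow> nrm (inv g) = nrm g"
    and nrm_conj: "\<lbrakk>g \<in> carrier G; h \<in> carrier G\<rbrakk> \<Longrightarrow> nrm (h \<otimes> g \<otimes> inv h) = nrm g"
    and nrm_eq_0_iff: "g \<in> carrier G \<Longrightarrow> nrm g = 0 \<longleftrightarrow> g = \<one>"

definition met_null ::
  "'i filter \<Rightarrow> ('i \<Rightarrow> ('a, 'm) monoid_scheme) \<Rightarrow> ('i \<Rightarrow> 'a \<Rightarrow> ennreal) \<Rightarrow> ('i \<Rightarrow> 'a) set"
  where "met_null \<U> G nrm =
    {g \<in> carrier (product_group UNIV G). ((\<lambda>i. nrm i (g i)) \<longlongrightarrow> 0) \<U>}"

definition met_ultraproduct ::
  "'i filter \<Rightarrow> ('i \<Rightarrow> ('a, 'm) monoid_scheme) \<Rightarrow> ('i \<Rightarrow> 'a \<Rightarrow> ennreal) \<Rightarrow> ('i \<Rightarrow> 'a) set monoid"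
  where "met_ultraproduct \<U> G nrm = product_group UNIV G Mod met_null \<U> G nrm"

(* The limit does not depend on the representative of the coset X, see met_ultraproduct_nrm_eq. *)
definition met_ultraproduct_nrm ::
  "'i filter \<Rightarrow> ('i \<Rightarrow> 'a \<Rightarrow> ennreal) \<Rightarrow> ('i \<Rightarrow> 'a) set \<Rightarrow> ennreal"
  where "met_ultraproduct_nrm \<U> nrm X = (THE l. \<forall>g\<in>X. ((\<lambda>i. nrm i (g i)) \<longlongrightarrow> l) \<U>)"

definition met_ultraproduct_fin ::
  "'i filter \<Rightarrow> ('i \<Rightarrow> ('a, 'm) monoid_scheme) \<Rightarrow> ('i \<Rightarrow> 'a \<Rightarrow> ennreal) \<Rightarrow> ('i \<Rightarrow> 'a) set monoid"
  where "met_ultraproduct_fin \<U> G nrm =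
    (met_ultraproduct \<U> G nrm)
      \<lparr>carrier := {X \<in> carrier (met_ultraproduct \<U> G nrm). met_ultraproduct_nrm \<U> nrm X < \<infinity>}\<rparr>"

(* The library locale simple_group demands order G > 1; as the order of an infinite group is 0,
   it covers only finite groups. *)
definition is_simple_grp :: "('a, 'm) monoid_scheme \<Rightarrow> bool"
  where "is_simple_grp G \<longleftrightarrow>
    group G \<and> carrier G \<noteq> {\<one>\<^bsub>G\<^esub>} \<and> (\<forall>N. N \<lhd> G \<longrightarrow> N = {\<one>\<^bsub>G\<^esub>} \<or> N = carrier G)"

definition conjs :: "('a, 'm) monoid_scheme \<Rightarrow> 'a \<Rightarrow> 'a set"
  where "conjs G g = {h \<otimes>\<^bsub>G\<^esub> g \<otimes>\<^bsub>G\<^esub> inv\<^bsub>G\<^esub> h | h. h \<in> carrier G}"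

definition boundedly_simple :: "('a, 'm) monoid_scheme \<Rightarrow> bool"
  where "boundedly_simple G \<longleftrightarrow>
    group G \<and> (\<forall>g \<in> carrier G - {\<one>\<^bsub>G\<^esub>}. \<exists>N::nat. \<forall>x \<in> carrier G.
      \<exists>ys. length ys \<le> N \<and> set ys \<subseteq> conjs G g \<union> conjs G (inv\<^bsub>G\<^esub> g) \<and>
           x = foldr (\<otimes>\<^bsub>G\<^esub>) ys \<one>\<^bsub>G\<^esub>)"

lemma ultrafilter_tendsto_ex:
  fixes f :: "'i \<Rightarrow> ennreal"
  assumes "ultrafilter \<U>"
  shows "\<exists>l. (f \<longlongrightarrow> l) \<U>"
proof -
  have "filtermap f \<U> \<noteq> bot"
    using assms by (simp add: ultrafilter_def filtermap_bot_iff)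
  then obtain l where l: "inf (nhds l) (filtermap f \<U>) \<noteq> bot"
    using compact_UNIV[where 'a=ennreal] unfolding compact_filter by auto
  have "eventually (\<lambda>i. f i \<in> S) \<U>" if S: "open S" "l \<in> S" for S
  proof (rule ccontr)
    assume "\<not> ?thesis"
    then have "eventually (\<lambda>i. f i \<notin> S) \<U>"
      using assms unfolding ultrafilter_def by blast
    then have "eventually (\<lambda>x. x \<notin> S) (filtermap f \<U>)"
      by (simp add: eventually_filtermap)
    moreover have "eventually (\<lambda>x. x \<in> S) (nhds l)"
      using S by (simp add: eventually_nhds) blast
    ultimately have "eventually (\<lambda>x. False) (inf (nhds l) (filtermap f \<U>))"
      unfolding eventually_inf by blast
    with l show False by (simp add: trivial_limit_def)
  qed
  then show ?thesis unfolding tendsto_def by blast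
qed

context
  fixes \<U> :: "'i filter" and G :: "'i \<Rightarrow> ('a, 'm) monoid_scheme" and nrm :: "'i \<Rightarrow> 'a \<Rightarrow> ennreal"
  assumes ultra: "ultrafilter \<U>" and mg: "\<And>i. metric_group (G i) (nrm i)"
begin

lemma group_G: "group (G i)"
  using mg[of i] by (simp add: metric_group_def)

lemma product_group_inv:
  "g \<in> carrier (product_group UNIV G) \<Longrightarrow> inv\<^bsub>product_group UNIV G\<^esub> g = (\<lambda>i. inv\<^bsub>G i\<^esub> g i)"
  using group_G inv_product_group[of g UNIV G] by (simp add: restrict_def)

lemma normal_met_null: "met_null \<U> G nrm \<lhd> product_group UNIV G"
proof -
  let ?P = "product_group UNIV G"
  interpret P: group ?P using group_G by auto
  have "subgroup (met_null \<U> G nrm) ?P"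
  proof
    show "met_null \<U> G nrm \<subseteq> carrier ?P" by (auto simp: met_null_def)
  next
    fix x y assume xy: "x \<in> met_null \<U> G nrm" "y \<in> met_null \<U> G nrm"
    then have c: "x i \<in> carrier (G i)" "y i \<in> carrier (G i)" for i
      by (auto simp: met_null_def)
    have "((\<lambda>i. nrm i (x i) + nrm i (y i)) \<longlongrightarrow> 0 + 0) \<U>"
      using xy by (intro tendsto_add[of "\<lambda>i. nrm i (x i)" 0 _ "\<lambda>i. nrm i (y i)" 0])
        (simp_all add: met_null_def)
    then have lim: "((\<lambda>i. nrm i (x i) + nrm i (y i)) \<longlongrightarrow> 0) \<U>"
      by simp
    have le: "nrm i (x i \<otimes>\<^bsub>G i\<^esub> y i) \<le> nrm i (x i) + nrm i (y i)" for i
      by (rule metric_group.nrm_mult_le[OF mg c])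
    have "((\<lambda>i. nrm i (x i \<otimes>\<^bsub>G i\<^esub> y i)) \<longlongrightarrow> 0) \<U>"
      by (rule tendsto_sandwich[OF _ _ tendsto_const lim]) (simp_all add: le)
    moreover have "x \<otimes>\<^bsub>?P\<^esub> y \<in> carrier ?P"
      using xy by (intro P.m_closed) (auto simp: met_null_def)
    ultimately show "x \<otimes>\<^bsub>?P\<^esub> y \<in> met_null \<U> G nrm"
      by (simp add: met_null_def)
  next
    have "nrm i \<one>\<^bsub>G i\<^esub> = 0" for i
      using metric_group.nrm_eq_0_iff[OF mg] group_G group.is_monoid monoid.one_closed by metis
    then show "\<one>\<^bsub>?P\<^esub> \<in> met_null \<U> G nrm"
      using P.one_closed by (simp add: met_null_def)
  next
    fix x assume x: "x \<in> met_null \<U> G nrm"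
    then have c: "x \<in> carrier ?P" "x i \<in> carrier (G i)" for i
      by (auto simp: met_null_def)
    show "inv\<^bsub>?P\<^esub> x \<in> met_null \<U> G nrm"
      using x P.inv_closed[OF c(1)] c
      by (simp add: met_null_def product_group_inv metric_group.nrm_inv[OF mg])
  qed
  moreover have "x \<otimes>\<^bsub>?P\<^esub> h \<otimes>\<^bsub>?P\<^esub> inv\<^bsub>?P\<^esub> x \<in> met_null \<U> G nrm"
    if h: "h \<in> met_null \<U> G nrm" and x: "x \<in> carrier ?P" for x h
  proof -
    have c: "h \<in> carrier ?P" "h i \<in> carrier (G i)" "x i \<in> carrier (G i)" for i
      using h x by (auto simp: met_null_def)
    have "x \<otimes>\<^bsub>?P\<^esub> h \<otimes>\<^bsub>?P\<^esub> inv\<^bsub>?P\<^esub> x \<in> carrier ?P"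
      using c x by (intro P.m_closed P.inv_closed)
    then show ?thesis
      using h c x product_group_inv[OF x]
      by (simp add: met_null_def metric_group.nrm_conj[OF mg])
  qed
  ultimately show ?thesis
    using P.normal_inv_iff by blast
qed

lemma met_ultraproduct_nrm_eq:
  assumes X: "X \<in> carrier (met_ultraproduct \<U> G nrm)" and g: "g \<in> X"
  shows "((\<lambda>i. nrm i (g i)) \<longlongrightarrow> met_ultraproduct_nrm \<U> nrm X) \<U>"
proof -
  let ?P = "product_group UNIV G"
  interpret P: group ?P using group_G by auto
  have nb: "\<U> \<noteq> bot" using ultra by (simp add: ultrafilter_def)
  obtain a where a: "a \<in> carrier ?P" "X = met_null \<U> G nrm #>\<^bsub>?P\<^esub> a"
    using X by (auto simp: met_ultraproduct_def FactGroup_def RCOSETS_def)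
  have ac: "a i \<in> carrier (G i)" for i using a by auto
  obtain l where l: "((\<lambda>i. nrm i (a i)) \<longlongrightarrow> l) \<U>"
    using ultrafilter_tendsto_ex[OF ultra] by blast
  have all: "((\<lambda>i. nrm i (b i)) \<longlongrightarrow> l) \<U>" if b: "b \<in> X" for b
  proof -
    obtain e where e: "e \<in> met_null \<U> G nrm" "b = e \<otimes>\<^bsub>?P\<^esub> a"
      using b a by (auto simp: r_coset_def)
    have ec: "e i \<in> carrier (G i)" for i using e by (auto simp: met_null_def)
    have bi: "b i = e i \<otimes>\<^bsub>G i\<^esub> a i" for i using e by simp
    obtain m where m: "((\<lambda>i. nrm i (b i)) \<longlongrightarrow> m) \<U>"
      using ultrafilter_tendsto_ex[OF ultra] by blast
    have e0: "((\<lambda>i. nrm i (e i)) \<longlongrightarrow> 0) \<U>" using e by (simp add: met_null_def)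
    have "nrm i (b i) \<le> nrm i (e i) + nrm i (a i)" for i
      unfolding bi by (rule metric_group.nrm_mult_le[OF mg ec ac])
    then have "m \<le> 0 + l"
      by (intro tendsto_le[OF nb tendsto_add[OF e0 l] m]) auto
    moreover have "nrm i (a i) \<le> nrm i (e i) + nrm i (b i)" for i
    proof -
      interpret group "G i" by (rule group_G)
      have "a i = inv\<^bsub>G i\<^esub> e i \<otimes>\<^bsub>G i\<^esub> b i"
        unfolding bi using ec ac by (simp add: m_assoc[symmetric])
      moreover have "nrm i (inv\<^bsub>G i\<^esub> e i \<otimes>\<^bsub>G i\<^esub> b i) \<le> nrm i (inv\<^bsub>G i\<^esub> e i) + nrm i (b i)"
        by (rule metric_group.nrm_mult_le[OF mg]) (auto simp: bi ec ac)
      ultimately show ?thesis by (simp add: metric_group.nrm_inv[OF mg ec])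
    qed
    then have "l \<le> 0 + m"
      by (intro tendsto_le[OF nb tendsto_add[OF e0 m] l]) auto
    ultimately show ?thesis using m by simp
  qed
  have "met_ultraproduct_nrm \<U> nrm X = l"
    unfolding met_ultraproduct_nrm_def
    using all g tendsto_unique[OF nb] by (intro the_equality) blast+
  with all g show ?thesis by simp
qed

end

end

theory Submission
  imports Defs
begin

text \<open>
  In a simple finitary ultraproduct every element is a product of conjugates of any given
  nontrivial $g$ and of its inverse. Simplicity passes to the ultrapower of $H$ as soon as the
  number of factors and the norms of the conjugators can be bounded uniformly in $g$, for
  $\|g\|$ bounded and bounded away from $0$: uniform bounds in $G_n$ carry over to pairs in $H$
  through the almost isometric copies. Saturation alone gives bounds that depend on the precision
  $\varepsilon$ of the approximation. A Baire category argument on pairs $(g, x)$ removes this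
  dependence: on some ball the number of factors is constant, so a fixed number of factors
  covers a neighbourhood of the identity, and it then suffices to approximate up to the radius of
  that neighbourhood.
\<close>

text \<open>The copies are indexed independently of the coordinates of the ultrapower. For sequences
  h and x in H, the pair (h m, x m) is copied from \<open>G n\<close> for \<U>-many n, and these n,
  the embeddings and the preimages all change with m. So a sequence in H does not come from a
  sequence in the family, and what is transferred must concern all relevant pairs in \<U>-many
  \<open>G n\<close> at once, with constants that serve every m. Approximating two elements is
  enough because conjugators are never approximated: they are found in \<open>G n\<close> and
  carried into H by the embedding, which preserves the bound K on their norms. That bound cannot be
  dropped, since conjugators of unbounded norm leave the finitary subgroup. A class is a word of
  length L exactly when one L and one K serve every \<epsilon>, see
  \<open>cls_in_conj_words_iff\<close>. This order of quantifiers is what the argument by saturation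
  alone fails to deliver.\<close>

section \<open>Products of conjugates\<close>

text \<open>The identity is included so that words of length \<open>L\<close> also account for shorter products.\<close>

definition conj_gens :: "('a, 'm) monoid_scheme \<Rightarrow> 'a set \<Rightarrow> 'a \<Rightarrow> 'a set"
  where "conj_gens G C g = insert \<one>\<^bsub>G\<^esub>
    {c \<otimes>\<^bsub>G\<^esub> s \<otimes>\<^bsub>G\<^esub> inv\<^bsub>G\<^esub> c | c s. c \<in> C \<and> s \<in> {g, inv\<^bsub>G\<^esub> g}}"

primrec conj_words :: "('a, 'm) monoid_scheme \<Rightarrow> 'a set \<Rightarrow> 'a \<Rightarrow> nat \<Rightarrow> 'a set"
  where "conj_words G C g 0 = {\<one>\<^bsub>G\<^esub>}"
  | "conj_words G C g (Suc L) = {y \<otimes>\<^bsub>G\<^esub> w | y w. y \<in> conj_gens G C g \<and> w \<in> conj_words G C g L}"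

lemma conj_words_mono: "C \<subseteq> C' \<Longrightarrow> conj_words G C g L \<subseteq> conj_words G C' g L"
  by (induction L) (auto simp: conj_gens_def, blast+)

context group
begin

lemma inv_mult_cancel_left:
  "\<lbrakk>x \<in> carrier G; y \<in> carrier G\<rbrakk> \<Longrightarrow> inv x \<otimes> (x \<otimes> y) = y"
  "\<lbrakk>x \<in> carrier G; y \<in> carrier G\<rbrakk> \<Longrightarrow> x \<otimes> (inv x \<otimes> y) = y"
  by (simp_all add: m_assoc[symmetric])

lemma conj_gens_closed: "\<lbrakk>C \<subseteq> carrier G; g \<in> carrier G\<rbrakk> \<Longrightarrow> conj_gens G C g \<subseteq> carrier G"
  by (auto simp: conj_gens_def)

lemma conj_words_closed: "\<lbrakk>C \<subseteq> carrier G; g \<in> carrier G\<rbrakk> \<Longrightarrow> conj_words G C g L \<subseteq> carrier G"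
  by (induction L) (auto dest: conj_gens_closed[THEN subsetD])

lemma conj_words_incseq:
  assumes "C \<subseteq> carrier G" "g \<in> carrier G" "L \<le> L'"
  shows "conj_words G C g L \<subseteq> conj_words G C g L'"
proof (rule lift_Suc_mono_le[OF _ assms(3)])
  fix n
  show "conj_words G C g n \<subseteq> conj_words G C g (Suc n)"
  proof
    fix w assume w: "w \<in> conj_words G C g n"
    then have "w = \<one> \<otimes> w" using conj_words_closed[OF assms(1,2), of n] by (simp add: subset_iff)
    then show "w \<in> conj_words G C g (Suc n)" using w by (auto simp: conj_gens_def)
  qed
qed

lemma one_in_conj_words:
  "\<lbrakk>C \<subseteq> carrier G; g \<in> carrier G\<rbrakk> \<Longrightarrow> \<one> \<in> conj_words G C g L"
  using conj_words_incseq[of C g 0 L] by auto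

lemma conj_gens_in_conj_words:
  "\<lbrakk>C \<subseteq> carrier G; g \<in> carrier G; y \<in> conj_gens G C g\<rbrakk> \<Longrightarrow> y \<in> conj_words G C g (Suc 0)"
  using conj_gens_closed[of C g] by (auto intro!: exI[of _ y])

lemma conj_words_mult:
  assumes C: "C \<subseteq> carrier G" "g \<in> carrier G"
    and "w \<in> conj_words G C g L" "v \<in> conj_words G C g M"
  shows "w \<otimes> v \<in> conj_words G C g (L + M)"
  using assms(3)
proof (induction L arbitrary: w)
  case 0
  then show ?case using assms conj_words_closed[OF C, of M] by (auto simp: subset_iff)
next
  case (Suc L)
  then obtain y u where y: "y \<in> conj_gens G C g" "u \<in> conj_words G C g L" "w = y \<otimes> u"
    by auto
  have "w \<otimes> v = y \<otimes> (u \<otimes> v)"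
    using y assms(4) conj_words_closed[OF C] conj_gens_closed[OF C] by (auto intro!: m_assoc)
  then show ?case using Suc.IH[OF y(2)] y by auto
qed

lemma conj_gens_inv:
  assumes C: "C \<subseteq> carrier G" "g \<in> carrier G" and "y \<in> conj_gens G C g"
  shows "inv y \<in> conj_gens G C g"
proof (cases "y = \<one>")
  case True
  then show ?thesis by (simp add: conj_gens_def)
next
  case False
  then obtain c s where c: "c \<in> C" "s \<in> {g, inv g}" "y = c \<otimes> s \<otimes> inv c"
    using assms by (auto simp: conj_gens_def)
  have "inv y = c \<otimes> inv s \<otimes> inv c"
    using c C by (auto simp: inv_mult_group m_assoc subset_iff)
  moreover have "inv s \<in> {g, inv g}" using c C by auto
  ultimately show ?thesis using c(1) unfolding conj_gens_def by blast
qed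

lemma conj_words_inv:
  assumes C: "C \<subseteq> carrier G" "g \<in> carrier G" and "w \<in> conj_words G C g L"
  shows "inv w \<in> conj_words G C g L"
  using assms(3)
proof (induction L arbitrary: w)
  case (Suc L)
  then obtain y u where y: "y \<in> conj_gens G C g" "u \<in> conj_words G C g L" "w = y \<otimes> u"
    by auto
  have "inv w = inv u \<otimes> inv y"
    using y conj_words_closed[OF C] conj_gens_closed[OF C] by (auto intro!: inv_mult_group)
  moreover have "inv u \<otimes> inv y \<in> conj_words G C g (L + Suc 0)"
    by (intro conj_words_mult C Suc.IH y conj_gens_in_conj_words conj_gens_inv)
  ultimately show ?case by (simp only: add_Suc_right add_0_right)
qed auto

lemma conj_mult:
  "\<lbrakk>c \<in> carrier G; x \<in> carrier G; y \<in> carrier G\<rbrakk> \<Longrightarrow>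
    c \<otimes> (x \<otimes> y) \<otimes> inv c = (c \<otimes> x \<otimes> inv c) \<otimes> (c \<otimes> y \<otimes> inv c)"
  by (simp add: m_assoc inv_mult_cancel_left)

text \<open>Conjugation passes to each factor and only multiplies its conjugator by c on the left,
  so the number of factors stays the same.\<close>

lemma conj_words_conj:
  assumes C: "C \<subseteq> carrier G" "g \<in> carrier G" and c: "c \<in> carrier G"
    and C': "\<And>d. d \<in> C \<Longrightarrow> c \<otimes> d \<in> C'" and "w \<in> conj_words G C g L"
  shows "c \<otimes> w \<otimes> inv c \<in> conj_words G C' g L"
  using assms(5)
proof (induction L arbitrary: w)
  case 0
  then show ?case using c by simp
next
  case (Suc L)
  then obtain y u where y: "y \<in> conj_gens G C g" "u \<in> conj_words G C g L" "w = y \<otimes> u"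
    by auto
  have "c \<otimes> w \<otimes> inv c = (c \<otimes> y \<otimes> inv c) \<otimes> (c \<otimes> u \<otimes> inv c)"
    unfolding y(3) using y conj_words_closed[OF C] conj_gens_closed[OF C] c
    by (intro conj_mult) auto
  moreover have "c \<otimes> y \<otimes> inv c \<in> conj_gens G C' g"
  proof (cases "y = \<one>")
    case True
    then show ?thesis using c by (simp add: conj_gens_def)
  next
    case False
    then obtain d s where d: "d \<in> C" "s \<in> {g, inv g}" "y = d \<otimes> s \<otimes> inv d"
      using y by (auto simp: conj_gens_def)
    have "c \<otimes> y \<otimes> inv c = (c \<otimes> d) \<otimes> s \<otimes> inv (c \<otimes> d)"
      using d C c by (auto simp: inv_mult_group m_assoc subset_iff)
    then show ?thesis using C'[OF d(1)] d(2) unfolding conj_gens_def by blast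
  qed
  ultimately show ?case using Suc.IH[OF y(2)] by auto
qed

text \<open>Substitution of a word in g for h. Each conjugate of h or of its inverse becomes a word
  of length L in g, so lengths multiply, and the conjugators that arise are products, which
  \<open>C''\<close> has to contain.\<close>

lemma conj_words_comp:
  assumes C: "C \<subseteq> carrier G" "g \<in> carrier G" and C': "C' \<subseteq> carrier G" and C'': "C'' \<subseteq> carrier G"
    and CC: "\<And>c d. \<lbrakk>c \<in> C'; d \<in> C\<rbrakk> \<Longrightarrow> c \<otimes> d \<in> C''" and h: "h \<in> conj_words G C g L"
    and "x \<in> conj_words G C' h M"
  shows "x \<in> conj_words G C'' g (M * L)"
  using assms(7)
proof (induction M arbitrary: x)
  case (Suc M)
  then obtain y u where y: "y \<in> conj_gens G C' h" "u \<in> conj_words G C' h M" "x = y \<otimes> u"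
    by auto
  have "y \<in> conj_words G C'' g L"
  proof (cases "y = \<one>")
    case True
    then show ?thesis using one_in_conj_words[OF C'' C(2)] by simp
  next
    case False
    then obtain c s where c: "c \<in> C'" "s \<in> {h, inv h}" "y = c \<otimes> s \<otimes> inv c"
      using y by (auto simp: conj_gens_def)
    have "s \<in> conj_words G C g L" using c h conj_words_inv[OF C] by auto
    then show ?thesis unfolding c(3)
      using c C' CC by (intro conj_words_conj[OF C]) auto
  qed
  then show ?case using conj_words_mult[OF C'' C(2) _ Suc.IH[OF y(2)]] y(3) by simp
qed auto

end

lemma conj_words_hom:
  assumes G: "group G" and H: "group H" and \<phi>: "\<phi> \<in> hom G H"
    and C: "C \<subseteq> carrier G" "g \<in> carrier G" and C': "\<And>c. c \<in> C \<Longrightarrow> \<phi> c \<in> C'"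
    and "w \<in> conj_words G C g L"
  shows "\<phi> w \<in> conj_words H C' (\<phi> g) L"
  using assms(7)
proof (induction L arbitrary: w)
  interpret group_hom G H \<phi> using G H \<phi> by (simp add: group_hom_def group_hom_axioms_def)
  {
    case 0
    then show ?case by simp
  next
    case (Suc L)
    then obtain y u where y: "y \<in> conj_gens G C g" "u \<in> conj_words G C g L"
        "w = y \<otimes>\<^bsub>G\<^esub> u"
      by auto
    have "\<phi> y \<in> conj_gens H C' (\<phi> g)"
    proof (cases "y = \<one>\<^bsub>G\<^esub>")
      case True
      then show ?thesis by (simp add: conj_gens_def)
    next
      case False
      then obtain c s where c: "c \<in> C" "s \<in> {g, inv\<^bsub>G\<^esub> g}"
          "y = c \<otimes>\<^bsub>G\<^esub> s \<otimes>\<^bsub>G\<^esub> inv\<^bsub>G\<^esub> c"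
        using y by (auto simp: conj_gens_def)
      have "\<phi> y = \<phi> c \<otimes>\<^bsub>H\<^esub> \<phi> s \<otimes>\<^bsub>H\<^esub> inv\<^bsub>H\<^esub> \<phi> c"
        using c C by auto
      moreover have "\<phi> s \<in> {\<phi> g, inv\<^bsub>H\<^esub> \<phi> g}" using c C by auto
      ultimately show ?thesis using C'[OF c(1)] unfolding conj_gens_def by blast
    qed
    moreover have "\<phi> w = \<phi> y \<otimes>\<^bsub>H\<^esub> \<phi> u"
      using y G.conj_words_closed[OF C, of L] G.conj_gens_closed[OF C] by (auto simp: subset_iff)
    ultimately show ?case using Suc.IH[OF y(2)] by auto
  }
qed

section \<open>Words, lists of conjugates and normal closures\<close>

context group
begin

lemma conj_gens_eq_conjs:
  assumes "g \<in> carrier G"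
  shows "conj_gens G (carrier G) g = insert \<one> (conjs G g \<union> conjs G (inv g))"
  by (auto simp: conj_gens_def conjs_def)

lemma conj_words_iff_list:
  assumes g: "g \<in> carrier G"
  shows "x \<in> conj_words G (carrier G) g L \<longleftrightarrow>
    (\<exists>ys. length ys \<le> L \<and> set ys \<subseteq> conjs G g \<union> conjs G (inv g) \<and> x = foldr (\<otimes>) ys \<one>)"
proof
  show "\<exists>ys. length ys \<le> L \<and> set ys \<subseteq> conjs G g \<union> conjs G (inv g) \<and> x = foldr (\<otimes>) ys \<one>"
    if "x \<in> conj_words G (carrier G) g L"
    using that
  proof (induction L arbitrary: x)
    case (Suc L)
    then obtain y w where y: "y \<in> conj_gens G (carrier G) g" "w \<in> conj_words G (carrier G) g L" "x = y \<otimes> w"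
      by auto
    obtain ys where ys: "length ys \<le> L" "set ys \<subseteq> conjs G g \<union> conjs G (inv g)" "w = foldr (\<otimes>) ys \<one>"
      using Suc.IH[OF y(2)] by blast
    have "w \<in> carrier G" using y(2) conj_words_closed[OF subset_refl g] by blast
    show ?case
    proof (cases "y = \<one>")
      case True
      then show ?thesis using y(3) ys \<open>w \<in> carrier G\<close> by (intro exI[of _ ys]) auto
    next
      case False
      then show ?thesis using y(1,3) ys
        by (intro exI[of _ "y # ys"]) (auto simp: conj_gens_eq_conjs[OF g])
    qed
  qed auto
next
  assume "\<exists>ys. length ys \<le> L \<and> set ys \<subseteq> conjs G g \<union> conjs G (inv g) \<and> x = foldr (\<otimes>) ys \<one>"
  then obtain ys where ys: "length ys \<le> L" "set ys \<subseteq> conjs G g \<union> conjs G (inv g)" "x = foldr (\<otimes>) ys \<one>"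
    by blast
  have "foldr (\<otimes>) ys \<one> \<in> conj_words G (carrier G) g (length ys)"
    using ys(2) by (induction ys) (auto simp: conj_gens_eq_conjs[OF g])
  then show "x \<in> conj_words G (carrier G) g L"
    using conj_words_incseq[OF subset_refl g ys(1)] ys(3) by blast
qed

text \<open>Together with \<open>conj_words_subset_normal\<close> this makes the union the normal
  closure of g, which is how simplicity becomes a statement about words.\<close>

lemma normal_UN_conj_words:
  assumes g: "g \<in> carrier G"
  shows "(\<Union>L. conj_words G (carrier G) g L) \<lhd> G"
  unfolding normal_inv_iff
proof (intro conjI ballI)
  show "subgroup (\<Union>L. conj_words G (carrier G) g L) G"
  proof
    show "(\<Union>L. conj_words G (carrier G) g L) \<subseteq> carrier G"
      using conj_words_closed[OF subset_refl g] by blast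
    show "\<one> \<in> (\<Union>L. conj_words G (carrier G) g L)"
      using one_in_conj_words[OF subset_refl g] by blast
    show "x \<otimes> y \<in> (\<Union>L. conj_words G (carrier G) g L)"
      if xy: "x \<in> (\<Union>L. conj_words G (carrier G) g L)" "y \<in> (\<Union>L. conj_words G (carrier G) g L)" for x y
    proof -
      obtain L M where "x \<in> conj_words G (carrier G) g L" "y \<in> conj_words G (carrier G) g M"
        using xy by auto
      then show ?thesis using conj_words_mult[OF subset_refl g] by blast
    qed
    show "inv x \<in> (\<Union>L. conj_words G (carrier G) g L)"
      if x: "x \<in> (\<Union>L. conj_words G (carrier G) g L)" for x
    proof -
      obtain L where "x \<in> conj_words G (carrier G) g L" using x by auto
      then show ?thesis using conj_words_inv[OF subset_refl g] by blast
    qed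
  qed
  show "x \<otimes> h \<otimes> inv x \<in> (\<Union>L. conj_words G (carrier G) g L)"
    if x: "x \<in> carrier G" and h: "h \<in> (\<Union>L. conj_words G (carrier G) g L)" for x h
  proof -
    obtain L where L: "h \<in> conj_words G (carrier G) g L" using h by auto
    have "x \<otimes> h \<otimes> inv x \<in> conj_words G (carrier G) g L"
      using x by (intro conj_words_conj[OF subset_refl g _ _ L]) auto
    then show ?thesis by blast
  qed
qed

lemma conj_words_subset_normal:
  assumes N: "N \<lhd> G" and g: "g \<in> N"
  shows "conj_words G (carrier G) g L \<subseteq> N"
proof -
  interpret N: normal N G by (rule N)
  have "conj_gens G (carrier G) g \<subseteq> N"
    using g N.inv_op_closed2 by (auto simp: conj_gens_def)
  then show ?thesis by (induction L) auto
qed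

end

lemma is_simple_grp_iff_conj_words:
  "is_simple_grp G \<longleftrightarrow> group G \<and> carrier G \<noteq> {\<one>\<^bsub>G\<^esub>} \<and>
    (\<forall>g \<in> carrier G - {\<one>\<^bsub>G\<^esub>}. \<forall>x \<in> carrier G. \<exists>L. x \<in> conj_words G (carrier G) g L)"
proof (cases "group G")
  case True
  then interpret group G .
  have "(\<forall>N. N \<lhd> G \<longrightarrow> N = {\<one>\<^bsub>G\<^esub>} \<or> N = carrier G) \<longleftrightarrow>
    (\<forall>g \<in> carrier G - {\<one>\<^bsub>G\<^esub>}. \<forall>x \<in> carrier G. \<exists>L. x \<in> conj_words G (carrier G) g L)"
  proof (intro iffI allI impI ballI)
    fix g x assume N: "\<forall>N. N \<lhd> G \<longrightarrow> N = {\<one>\<^bsub>G\<^esub>} \<or> N = carrier G"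
      and "g \<in> carrier G - {\<one>\<^bsub>G\<^esub>}" and x: "x \<in> carrier G"
    then have g: "g \<in> carrier G" "g \<noteq> \<one>\<^bsub>G\<^esub>" by auto
    have "\<one>\<^bsub>G\<^esub> \<otimes>\<^bsub>G\<^esub> g \<otimes>\<^bsub>G\<^esub> inv\<^bsub>G\<^esub> \<one>\<^bsub>G\<^esub> \<in> conj_gens G (carrier G) g"
      unfolding conj_gens_def using one_closed by blast
    then have "g \<in> conj_words G (carrier G) g (Suc 0)"
      using g by (intro conj_gens_in_conj_words) auto
    then have "(\<Union>L. conj_words G (carrier G) g L) = carrier G"
      using N normal_UN_conj_words[OF g(1)] g(2) by blast
    then show "\<exists>L. x \<in> conj_words G (carrier G) g L" using x by blast
  next
    fix N assume words: "\<forall>g \<in> carrier G - {\<one>\<^bsub>G\<^esub>}. \<forall>x \<in> carrier G. \<exists>L. x \<in> conj_words G (carrier G) g L"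
      and N: "N \<lhd> G"
    interpret N: normal N G by (rule N)
    have "N = carrier G" if g: "g \<in> N" "g \<noteq> \<one>\<^bsub>G\<^esub>" for g
    proof -
      have "\<forall>x \<in> carrier G. \<exists>L. x \<in> conj_words G (carrier G) g L"
        using words g N.subset by auto
      then show ?thesis using conj_words_subset_normal[OF N g(1)] N.subset by blast
    qed
    then show "N = {\<one>\<^bsub>G\<^esub>} \<or> N = carrier G" using N.one_closed by blast
  qed
  then show ?thesis using True by (simp add: is_simple_grp_def)
qed (simp add: is_simple_grp_def)

lemma boundedly_simple_iff_conj_words:
  "boundedly_simple G \<longleftrightarrow> group G \<and>
    (\<forall>g \<in> carrier G - {\<one>\<^bsub>G\<^esub>}. \<exists>L. \<forall>x \<in> carrier G. x \<in> conj_words G (carrier G) g L)"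
  unfolding boundedly_simple_def
  by (intro conj_cong refl ball_cong ex_cong1) (simp add: group.conj_words_iff_list)

section \<open>Ultrafilters and extended reals\<close>

lemma ennreal_add_strict_mono:
  fixes a b c d :: ennreal
  assumes "a < c" "b < d"
  shows "a + b < c + d"
proof -
  have "a < \<infinity>" "b < \<infinity>" using assms by (auto intro: order_less_le_trans)
  then have "a + b < a + d" using assms by (simp add: ennreal_add_left_cancel_less less_top)
  also have "\<dots> \<le> c + d" using assms by (intro add_mono) auto
  finally show ?thesis .
qed

lemma ennreal_small_multiple:
  fixes \<epsilon> :: ennreal
  assumes "\<epsilon> > 0"
  shows "\<exists>r>0. r < \<infinity> \<and> of_nat m * r \<le> \<epsilon>"
proof -
  \<comment> \<open>As \<epsilon> may be infinite, a finite positive value below it is divided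
    instead. The divisor m + 1 also covers m = 0.\<close>
  obtain d where d: "0 < d" "d < \<epsilon>" using dense[OF assms] by blast
  then obtain e where e: "d = ennreal e" "0 < e"
    by (cases d) auto
  have "of_nat m * ennreal (e / (real m + 1)) = ennreal (real m * (e / (real m + 1)))"
    using e by (simp only: ennreal_of_nat_eq_real_of_nat) (rule ennreal_mult'[symmetric], simp)
  also have "\<dots> \<le> ennreal e"
    using e by (intro ennreal_leI) (simp add: field_simps)
  finally show ?thesis using e d by (intro exI[of _ "ennreal (e / (real m + 1))"]) auto
qed

text \<open>An ultrafilter with a singleton as a member is principal, so here every point, and hence
  every finite set, can be discarded.\<close>

lemma nonprincipal_ultrafilter_ge:
  assumes "nonprincipal_ultrafilter (\<U> :: nat filter)"
  shows "\<forall>\<^sub>F n in \<U>. k \<le> n"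
proof -
  have u: "ultrafilter \<U>" using assms by (simp add: nonprincipal_ultrafilter_def)
  have "\<forall>\<^sub>F n in \<U>. n \<noteq> i" for i
  proof (rule ccontr)
    assume "\<not> (\<forall>\<^sub>F n in \<U>. n \<noteq> i)"
    then have i: "\<forall>\<^sub>F n in \<U>. n = i" using u by (auto simp: ultrafilter_def)
    have "eventually P \<U> \<longleftrightarrow> P i" for P
    proof
      assume "eventually P \<U>"
      then have "\<forall>\<^sub>F n in \<U>. P i" using i by eventually_elim auto
      then show "P i" using u by (auto simp: ultrafilter_def eventually_const)
    next
      assume "P i"
      then show "eventually P \<U>" using i by (auto elim: eventually_mono)
    qed
    then have "\<U> = principal {i}" by (simp add: filter_eq_iff eventually_principal)
    then show False using assms by (auto simp: nonprincipal_ultrafilter_def)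
  qed
  then have "\<forall>\<^sub>F n in \<U>. \<forall>i\<in>{..<k}. n \<noteq> i"
    by (intro eventually_ball_finite) auto
  then show ?thesis by eventually_elim (auto simp: not_le[symmetric])
qed

text \<open>Countable saturation by diagonalization: at coordinate n the point is taken from the
  deepest nonempty intersection of depth at most n. Depth k is reached wherever n is at least k and
  the k-th intersection is nonempty, hence for \<U>-many n.\<close>

lemma ultrafilter_saturation:
  fixes B :: "nat \<Rightarrow> nat \<Rightarrow> 'c set"
  assumes \<U>: "nonprincipal_ultrafilter \<U>"
    and fip: "\<And>k. \<forall>\<^sub>F n in \<U>. S n \<inter> (\<Inter>j\<le>k. B j n) \<noteq> {}"
    and S: "\<And>n. S n \<noteq> {}"
  shows "\<exists>z. (\<forall>n. z n \<in> S n) \<and> (\<forall>k. \<forall>\<^sub>F n in \<U>. z n \<in> B k n)"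
proof -
  define I where "I k n = S n \<inter> (\<Inter>j\<le>k. B j n)" for k n
  \<comment> \<open>The bound by n makes the maximum exist; it is harmless because \<U> contains no
    finite set.\<close>
  define N where "N n = (GREATEST k. k \<le> n \<and> I k n \<noteq> {})" for n
  \<comment> \<open>The default is a point of \<open>S n\<close>, so that z stays in the prescribed
    sets at every coordinate and not just at \<U>-many.\<close>
  define z where "z n = (if \<exists>k\<le>n. I k n \<noteq> {} then SOME c. c \<in> I (N n) n else SOME c. c \<in> S n)" for n
  have N: "k \<le> N n \<and> z n \<in> I (N n) n" if "k \<le> n" "I k n \<noteq> {}" for k n
  proof -
    have "N n \<le> n \<and> I (N n) n \<noteq> {}"
      unfolding N_def by (rule GreatestI_nat[where k = k and b = n]) (use that in auto)
    moreover have "k \<le> N n"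
      unfolding N_def by (rule Greatest_le_nat[where b = n]) (use that in auto)
    ultimately show ?thesis using that by (auto simp: z_def some_in_eq)
  qed
  have "\<forall>\<^sub>F n in \<U>. z n \<in> B k n" for k
    using nonprincipal_ultrafilter_ge[OF \<U>, of k] fip[of k]
  proof eventually_elim
    case (elim n)
    then show ?case using N[of k n] by (auto simp: I_def)
  qed
  moreover have "z n \<in> S n" for n
  proof (cases "\<exists>k\<le>n. I k n \<noteq> {}")
    case True
    then show ?thesis using N by (auto simp: I_def)
  next
    case False
    then show ?thesis using S by (auto simp: z_def some_in_eq)
  qed
  ultimately show ?thesis by blast
qed

section \<open>Metric groups\<close>

context metric_group
begin

definition gdist :: "'a \<Rightarrow> 'a \<Rightarrow> ennreal"
  where "gdist x y = nrm (x \<otimes> inv y)"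

lemma nrm_one [simp]: "nrm \<one> = 0"
  using nrm_eq_0_iff by simp

lemma gdist_self [simp]: "x \<in> carrier G \<Longrightarrow> gdist x x = 0"
  by (simp add: gdist_def)

lemma gdist_commute: "\<lbrakk>x \<in> carrier G; y \<in> carrier G\<rbrakk> \<Longrightarrow> gdist x y = gdist y x"
  using nrm_inv[of "x \<otimes> inv y"] by (simp add: gdist_def inv_mult_group)

lemma gdist_triangle:
  assumes "x \<in> carrier G" "y \<in> carrier G" "z \<in> carrier G"
  shows "gdist x z \<le> gdist x y + gdist y z"
proof -
  have "x \<otimes> inv z = (x \<otimes> inv y) \<otimes> (y \<otimes> inv z)"
    using assms by (simp add: m_assoc inv_mult_cancel_left)
  then show ?thesis
    using nrm_mult_le[of "x \<otimes> inv y" "y \<otimes> inv z"] assms by (simp add: gdist_def)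
qed

lemma gdist_conj:
  assumes "x \<in> carrier G" "y \<in> carrier G" "c \<in> carrier G"
  shows "gdist (c \<otimes> x \<otimes> inv c) (c \<otimes> y \<otimes> inv c) = gdist x y"
proof -
  have "c \<otimes> x \<otimes> inv c \<otimes> inv (c \<otimes> y \<otimes> inv c) = c \<otimes> (x \<otimes> inv y) \<otimes> inv c"
    using assms by (simp add: m_assoc inv_mult_group inv_mult_cancel_left)
  then show ?thesis using nrm_conj assms by (simp add: gdist_def)
qed

lemma gdist_inv:
  assumes "x \<in> carrier G" "y \<in> carrier G"
  shows "gdist (inv x) (inv y) = gdist x y"
proof -
  have "inv x \<otimes> y = inv x \<otimes> (y \<otimes> inv x) \<otimes> inv (inv x)"
    using assms by (simp add: m_assoc)
  then have "gdist (inv x) (inv y) = gdist y x"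
    using nrm_conj[of "y \<otimes> inv x" "inv x"] assms by (simp add: gdist_def)
  then show ?thesis using gdist_commute assms by simp
qed

lemma gdist_mult:
  assumes "x \<in> carrier G" "y \<in> carrier G" "x' \<in> carrier G" "y' \<in> carrier G"
  shows "gdist (x \<otimes> y) (x' \<otimes> y') \<le> gdist x x' + gdist y y'"
proof -
  have "x \<otimes> y \<otimes> inv (x' \<otimes> y') = (x \<otimes> (y \<otimes> inv y') \<otimes> inv x) \<otimes> (x \<otimes> inv x')"
    using assms by (simp add: m_assoc inv_mult_group inv_mult_cancel_left)
  then show ?thesis
    using nrm_mult_le[of "x \<otimes> (y \<otimes> inv y') \<otimes> inv x" "x \<otimes> inv x'"] assms
    by (simp add: gdist_def nrm_conj add.commute)
qed

lemma nrm_le_gdist: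
  assumes "x \<in> carrier G" "y \<in> carrier G"
  shows "nrm x \<le> nrm y + gdist x y"
  using gdist_triangle[of x y \<one>] assms by (simp add: gdist_def add.commute)

lemma conj_gens_perturb:
  assumes C: "C \<subseteq> carrier G" "g \<in> carrier G" "h \<in> carrier G"
    and "y \<in> conj_gens G C g"
  shows "\<exists>v \<in> conj_gens G C h. gdist y v \<le> gdist g h"
proof (cases "y = \<one>")
  case True
  then show ?thesis by (auto simp: conj_gens_def)
next
  case False
  then obtain c s where c: "c \<in> C" "s \<in> {g, inv g}" "y = c \<otimes> s \<otimes> inv c"
    using assms by (auto simp: conj_gens_def)
  define s' where "s' = (if s = g then h else inv h)"
  have "c \<otimes> s' \<otimes> inv c \<in> conj_gens G C h"
    using c(1) by (auto simp: conj_gens_def s'_def)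
  moreover have "gdist y (c \<otimes> s' \<otimes> inv c) = gdist s s'"
    unfolding c(3) using c(1,2) C by (intro gdist_conj) (auto simp: s'_def)
  moreover have "gdist s s' = gdist g h"
    using c(2) C gdist_inv by (auto simp: s'_def)
  ultimately show ?thesis by (metis order_refl)
qed

text \<open>Conjugation and inversion are isometries and distances add up along products, so a word
  is L-Lipschitz in its base element, whatever the conjugators are.\<close>

lemma conj_words_perturb:
  assumes C: "C \<subseteq> carrier G" "g \<in> carrier G" "h \<in> carrier G"
    and "w \<in> conj_words G C g L"
  shows "\<exists>v \<in> conj_words G C h L. gdist w v \<le> of_nat L * gdist g h"
  using assms(4)
proof (induction L arbitrary: w)
  case (Suc L)
  then obtain y u where y: "y \<in> conj_gens G C g" "u \<in> conj_words G C g L" "w = y \<otimes> u"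
    by auto
  obtain v where v: "v \<in> conj_gens G C h" "gdist y v \<le> gdist g h"
    using conj_gens_perturb[OF C y(1)] by auto
  obtain z where z: "z \<in> conj_words G C h L" "gdist u z \<le> of_nat L * gdist g h"
    using Suc.IH[OF y(2)] by auto
  have "gdist w (v \<otimes> z) \<le> gdist y v + gdist u z"
    unfolding y(3) using y v z conj_words_closed[OF C(1)] conj_gens_closed[OF C(1)] C
    by (intro gdist_mult) blast+
  also have "\<dots> \<le> gdist g h + of_nat L * gdist g h"
    by (intro add_mono v z)
  also have "\<dots> = of_nat (Suc L) * gdist g h" by (simp add: distrib_right)
  finally show ?case using v(1) z(1) by auto
qed auto

section \<open>Approximation by words with bounded conjugators\<close>

definition nball :: "nat \<Rightarrow> 'a set"
  where "nball K = {c \<in> carrier G. nrm c \<le> of_nat K}"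

lemma nball_closed: "nball K \<subseteq> carrier G"
  by (auto simp: nball_def)

lemma nball_mono: "K \<le> K' \<Longrightarrow> nball K \<subseteq> nball K'"
  by (auto simp: nball_def intro: order_trans of_nat_mono)

lemma nball_mult: "\<lbrakk>c \<in> nball K; d \<in> nball K'\<rbrakk> \<Longrightarrow> c \<otimes> d \<in> nball (K + K')"
  by (auto simp: nball_def intro!: order_trans[OF nrm_mult_le] add_mono)

text \<open>The norms of conjugators are bounded because sequences of conjugators must define
  elements of the finitary subgroup. The bound is a natural number so that one K can bound both the
  length and the norms.\<close>

definition near :: "nat \<Rightarrow> nat \<Rightarrow> ennreal \<Rightarrow> 'a \<Rightarrow> 'a \<Rightarrow> bool"
  where "near L K \<epsilon> g x \<longleftrightarrow> (\<exists>w \<in> conj_words G (nball K) g L. gdist x w < \<epsilon>)"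

lemma near_mono:
  assumes "near L K \<epsilon> g x" "g \<in> carrier G" "L \<le> L'" "K \<le> K'" "\<epsilon> \<le> \<epsilon>'"
  shows "near L' K' \<epsilon>' g x"
  using assms conj_words_mono[OF nball_mono[OF assms(4)], of G g L]
    conj_words_incseq[OF nball_closed assms(2,3), of K']
  unfolding near_def by (meson order_less_le_trans subsetD)

text \<open>The L + 2 units of r pay for L factors whose base moves from g to h, for moving x to y,
  and for the original tolerance. Finiteness of r preserves the strict inequality.\<close>

lemma near_perturb:
  assumes "near L K \<epsilon> g x" and c: "g \<in> carrier G" "h \<in> carrier G" "x \<in> carrier G" "y \<in> carrier G"
    and r: "gdist g h \<le> r" "gdist y x \<le> r" "\<epsilon> \<le> r" "of_nat (L + 2) * r \<le> \<eta>" "r < \<infinity>"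
  shows "near L K \<eta> h y"
proof -
  obtain w where w: "w \<in> conj_words G (nball K) g L" "gdist x w < \<epsilon>"
    using assms(1) by (auto simp: near_def)
  obtain v where v: "v \<in> conj_words G (nball K) h L" "gdist w v \<le> of_nat L * gdist g h"
    using conj_words_perturb[OF nball_closed c(1,2) w(1)] by auto
  have wc: "w \<in> carrier G" "v \<in> carrier G"
    using w v conj_words_closed[OF nball_closed] c by blast+
  have wv: "gdist w v \<le> of_nat L * r"
    using v(2) r(1) by (meson mult_left_mono order_trans zero_le)
  have fin: "of_nat L * r < \<infinity>"
    using r(5) by (simp add: ennreal_mult_less_top of_nat_less_top)
  have "gdist y v \<le> gdist y x + gdist x v"
    by (intro gdist_triangle c wc)
  also have "\<dots> \<le> r + (gdist x w + of_nat L * r)"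
    by (intro add_mono r(2) order_trans[OF gdist_triangle[of x w v]] wv order_refl c wc)
  also have "\<dots> < r + (r + of_nat L * r)"
    using order_less_le_trans[OF w(2) r(3)] r(5) fin
    by (simp add: ennreal_add_left_cancel_less add.commute[of _ "of_nat L * r"] less_top)
  also have "\<dots> = of_nat (L + 2) * r"
    by (simp add: distrib_right mult_2 add_ac)
  finally have "gdist y v < \<eta>" using r(4) by (rule order_less_le_trans)
  then show ?thesis using v(1) by (auto simp: near_def)
qed

lemma near_comp:
  assumes g: "g \<in> carrier G" and h: "h \<in> conj_words G (nball M) g M" and near: "near N K \<epsilon> h x"
  shows "near (N * M) (K + M) \<epsilon> g x"
proof -
  obtain w where w: "w \<in> conj_words G (nball K) h N" "gdist x w < \<epsilon>"
    using near by (auto simp: near_def)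
  have "w \<in> conj_words G (nball (K + M)) g (N * M)"
    by (rule conj_words_comp[OF nball_closed g nball_closed nball_closed _ h w(1)]) (rule nball_mult)
  then show ?thesis using w(2) by (auto simp: near_def)
qed

text \<open>Write x as the product of e and w, where w is a word in g and e has norm below \<rho>.
  Then \<open>e \<otimes> x0\<close> and \<open>x0\<close> both lie in the \<rho>-ball around
  \<open>x0\<close>, so e, being their quotient, is within twice \<epsilon> of a quotient of two
  words of length k in h. Rewriting these in g gives the length (k + k) * M with conjugators of norm
  at most k + M, and w adds N and K. Neither the length nor the norm bound involves
  \<epsilon>.\<close>

lemma near_through:
  assumes g: "g \<in> carrier G" and h: "h \<in> conj_words G (nball M) g M"
    and x: "x \<in> carrier G" "near N K \<rho> g x" and x0: "x0 \<in> carrier G"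
    and ball: "\<And>z. \<lbrakk>z \<in> carrier G; gdist z x0 \<le> \<rho>\<rbrakk> \<Longrightarrow> near k k \<epsilon> h z"
    and \<epsilon>: "of_nat 2 * \<epsilon> \<le> \<eta>"
  shows "near ((k + k) * M + N) (k + M + K) \<eta> g x"
proof -
  have hc: "h \<in> carrier G" using h conj_words_closed[OF nball_closed g] by blast
  obtain w where w: "w \<in> conj_words G (nball K) g N" "gdist x w < \<rho>"
    using x(2) by (auto simp: near_def)
  have wc: "w \<in> carrier G" using w conj_words_closed[OF nball_closed g] by blast
  define e where "e = x \<otimes> inv w"
  have e: "e \<in> carrier G" "nrm e < \<rho>" "x = e \<otimes> w"
    using w wc x by (auto simp: e_def gdist_def m_assoc)
  have "gdist (e \<otimes> x0) x0 = nrm e" using e x0 by (simp add: gdist_def m_assoc)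
  then have "near k k \<epsilon> h (e \<otimes> x0)" using e x0 by (intro ball) auto
  then obtain u where u: "u \<in> conj_words G (nball k) h k" "gdist (e \<otimes> x0) u < \<epsilon>"
    by (auto simp: near_def)
  have "near k k \<epsilon> h x0" using x0 by (intro ball) auto
  then obtain v where v: "v \<in> conj_words G (nball k) h k" "gdist x0 v < \<epsilon>"
    by (auto simp: near_def)
  have uv: "u \<in> carrier G" "v \<in> carrier G"
    using u v conj_words_closed[OF nball_closed hc] by blast+
  let ?C = "nball (k + M + K)"
  have "u \<otimes> inv v \<in> conj_words G (nball k) h (k + k)"
    using u v by (intro conj_words_mult conj_words_inv nball_closed hc)
  then have "u \<otimes> inv v \<in> conj_words G (nball (k + M)) g ((k + k) * M)"
    by (intro conj_words_comp[OF nball_closed g nball_closed nball_closed nball_mult h])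
  moreover have "conj_words G (nball (k + M)) g ((k + k) * M) \<subseteq> conj_words G ?C g ((k + k) * M)"
    "conj_words G (nball K) g N \<subseteq> conj_words G ?C g N"
    by (auto intro!: conj_words_mono nball_mono)
  ultimately have word: "u \<otimes> inv v \<otimes> w \<in> conj_words G ?C g ((k + k) * M + N)"
    using w by (intro conj_words_mult nball_closed g) auto
  have "gdist x (u \<otimes> inv v \<otimes> w) \<le> gdist (e \<otimes> x0 \<otimes> inv x0) (u \<otimes> inv v) + gdist w w"
    unfolding e(3) using e wc uv x0 gdist_mult[of e w "u \<otimes> inv v" w] by (simp add: m_assoc)
  also have "\<dots> \<le> gdist (e \<otimes> x0) u + gdist (inv x0) (inv v)"
    using e wc uv x0 gdist_mult[of "e \<otimes> x0" "inv x0" u "inv v"] by simp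
  also have "\<dots> < \<epsilon> + \<epsilon>"
    using u(2) v(2) uv x0 by (intro ennreal_add_strict_mono) (simp_all add: gdist_inv)
  also have "\<dots> \<le> \<eta>" using \<epsilon> by (simp add: mult_2)
  finally show ?thesis using word by (auto simp: near_def)
qed

end

section \<open>Uniform word lengths in a family\<close>

locale metric_groups =
  fixes \<U> :: "nat filter" and G :: "nat \<Rightarrow> ('a, 'm) monoid_scheme" and nrm :: "nat \<Rightarrow> 'a \<Rightarrow> ennreal"
  assumes nonprincipal: "nonprincipal_ultrafilter \<U>"
    and metric_group: "\<And>n. metric_group (G n) (nrm n)"
begin

sublocale M: metric_group "G n" "nrm n" for n
  by (rule metric_group)

lemma ultra: "ultrafilter \<U>"
  using nonprincipal by (simp add: nonprincipal_ultrafilter_def)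

lemma not_bot: "\<U> \<noteq> bot"
  using ultra by (simp add: ultrafilter_def)

lemma not_eventually_iff: "\<not> (\<forall>\<^sub>F n in \<U>. P n) \<longleftrightarrow> (\<forall>\<^sub>F n in \<U>. \<not> P n)"
proof
  assume "\<not> (\<forall>\<^sub>F n in \<U>. P n)"
  then show "\<forall>\<^sub>F n in \<U>. \<not> P n" using ultra by (auto simp: ultrafilter_def)
next
  assume "\<forall>\<^sub>F n in \<U>. \<not> P n"
  then have "\<forall>\<^sub>F n in \<U>. False" if "\<forall>\<^sub>F n in \<U>. P n"
    using that by eventually_elim auto
  then show "\<not> (\<forall>\<^sub>F n in \<U>. P n)" using not_bot by auto
qed

text \<open>Membership in the carriers is asked at every n, so that the sequence is an element of
  the product; the norm bound only at \<U>-many, since the class sees no more.\<close>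

definition fin_seq :: "(nat \<Rightarrow> 'a) \<Rightarrow> bool"
  where "fin_seq x \<longleftrightarrow> (\<forall>n. x n \<in> carrier (G n)) \<and> (\<exists>T::nat. \<forall>\<^sub>F n in \<U>. nrm n (x n) \<le> of_nat T)"

definition nontriv_seq :: "(nat \<Rightarrow> 'a) \<Rightarrow> bool"
  where "nontriv_seq g \<longleftrightarrow> (\<exists>\<delta>>0. \<forall>\<^sub>F n in \<U>. \<delta> \<le> nrm n (g n))"

lemma fin_seq_carrier: "fin_seq x \<Longrightarrow> x n \<in> carrier (G n)"
  by (simp add: fin_seq_def)

text \<open>\<open>near\<close> is monotone, so the sets \<open>B K n\<close> of counterexamples
  shrink as K grows. If they were nonempty for \<U>-many n at every K, saturation would give one
  pair of sequences that defeats every K, against \<open>words\<close>. The function f is the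
  identity when the length is to be bounded as well, and constant when it is already known. The K
  obtained depends on \<epsilon>.\<close>

lemma near_uniform:
  assumes D: "\<And>n. D n \<subseteq> carrier (G n)" and f: "mono f" and \<epsilon>: "\<epsilon> > 0"
    and words: "\<And>g x. \<lbrakk>\<And>n. g n \<in> carrier (G n); \<forall>\<^sub>F n in \<U>. g n \<in> D n; fin_seq x\<rbrakk> \<Longrightarrow>
      \<exists>K. \<forall>\<epsilon>>0. \<forall>\<^sub>F n in \<U>. M.near n (f K) K \<epsilon> (g n) (x n)"
  shows "\<exists>K. \<forall>\<^sub>F n in \<U>. \<forall>g \<in> D n. \<forall>x \<in> carrier (G n). nrm n x \<le> of_nat T \<longrightarrow> M.near n (f K) K \<epsilon> g x"
proof (rule ccontr)
  define B where "B K n = {(g, x). g \<in> D n \<and> x \<in> carrier (G n) \<and> nrm n x \<le> of_nat T \<and>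
    \<not> M.near n (f K) K \<epsilon> g x}" for K n
  assume "\<not> ?thesis"
  then have ne: "\<forall>\<^sub>F n in \<U>. B K n \<noteq> {}" for K
    unfolding not_ex not_eventually_iff by (auto simp: B_def elim!: allE[of _ K] eventually_mono)
  have "B k n \<subseteq> (carrier (G n) \<times> carrier (G n)) \<inter> (\<Inter>j\<le>k. B j n)" for k n
    using D monoD[OF f] by (auto simp: B_def subset_iff intro: M.near_mono)
  then have "\<forall>\<^sub>F n in \<U>. (carrier (G n) \<times> carrier (G n)) \<inter> (\<Inter>j\<le>k. B j n) \<noteq> {}" for k
    by (intro eventually_mono[OF ne[of k]]) blast
  moreover have "carrier (G n) \<times> carrier (G n) \<noteq> {}" for n
    using M.one_closed by blast
  ultimately obtain z where z: "\<And>n. z n \<in> carrier (G n) \<times> carrier (G n)" "\<And>k. \<forall>\<^sub>F n in \<U>. z n \<in> B k n"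
    using ultrafilter_saturation[OF nonprincipal, of "\<lambda>n. carrier (G n) \<times> carrier (G n)" B] by auto
  define g x where "g n = fst (z n)" and "x n = snd (z n)" for n
  have gx: "g n \<in> carrier (G n)" "x n \<in> carrier (G n)" for n
    using z(1)[of n] by (auto simp: g_def x_def mem_Times_iff)
  have B: "\<forall>\<^sub>F n in \<U>. g n \<in> D n \<and> nrm n (x n) \<le> of_nat T \<and> \<not> M.near n (f k) k \<epsilon> (g n) (x n)" for k
    using z(2)[of k] by eventually_elim (auto simp: B_def g_def x_def)
  have "\<forall>\<^sub>F n in \<U>. g n \<in> D n" using B[of 0] by eventually_elim auto
  moreover have "fin_seq x"
    using gx B[of 0] by (auto simp: fin_seq_def intro!: exI[of _ T] elim: eventually_mono)
  ultimately obtain K where "\<forall>\<epsilon>>0. \<forall>\<^sub>F n in \<U>. M.near n (f K) K \<epsilon> (g n) (x n)"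
    using words[of g x] gx by auto
  then have "\<forall>\<^sub>F n in \<U>. M.near n (f K) K \<epsilon> (g n) (x n)" using \<epsilon> by blast
  then have "\<forall>\<^sub>F n in \<U>. False" using B[of K] by eventually_elim auto
  then show False using not_bot by auto
qed

section \<open>Balls of pairs and the category argument\<close>

definition cball2 :: "(nat \<Rightarrow> 'a) \<times> (nat \<Rightarrow> 'a) \<times> ennreal \<Rightarrow> nat \<Rightarrow> ('a \<times> 'a) set"
  where "cball2 = (\<lambda>(g, x, r) n. {(g', x'). g' \<in> carrier (G n) \<and> x' \<in> carrier (G n) \<and>
    M.gdist n g' (g n) \<le> r \<and> M.gdist n x' (x n) \<le> r})"

lemma mem_cball2: "(g', x') \<in> cball2 (g, x, r) n \<longleftrightarrow> g' \<in> carrier (G n) \<and> x' \<in> carrier (G n) \<and>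
    M.gdist n g' (g n) \<le> r \<and> M.gdist n x' (x n) \<le> r"
  by (simp add: cball2_def)

lemma eventually_choice:
  assumes "\<forall>\<^sub>F n in \<U>. \<exists>g \<in> carrier (G n). \<exists>x \<in> carrier (G n). P n g x"
  obtains g x where "\<And>n. g n \<in> carrier (G n)" "\<And>n. x n \<in> carrier (G n)" "\<forall>\<^sub>F n in \<U>. P n (g n) (x n)"
proof -
  define Q where "Q n = (\<lambda>(g, x). g \<in> carrier (G n) \<and> x \<in> carrier (G n) \<and> P n g x)" for n
  \<comment> \<open>The identity is the default where P has no solution, so that both sequences lie
    in the carriers everywhere.\<close>
  define z where "z n = (if \<exists>p. Q n p then SOME p. Q n p else (\<one>\<^bsub>G n\<^esub>, \<one>\<^bsub>G n\<^esub>))" for n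
  have z: "Q n (z n)" if "\<exists>p. Q n p" for n
    using that by (simp add: z_def someI_ex)
  have "fst (z n) \<in> carrier (G n) \<and> snd (z n) \<in> carrier (G n)" for n
    using z[of n] by (cases "\<exists>p. Q n p") (auto simp: Q_def z_def split: prod.splits)
  moreover have "\<forall>\<^sub>F n in \<U>. P n (fst (z n)) (snd (z n))"
    using assms
  proof eventually_elim
    case (elim n)
    then have "\<exists>p. Q n p" by (auto simp: Q_def)
    then show ?case using z[of n] by (auto simp: Q_def split: prod.splits)
  qed
  ultimately show ?thesis using that[of "\<lambda>n. fst (z n)" "\<lambda>n. snd (z n)"] by simp
qed

text \<open>Failure for size k and tolerance \<epsilon> at one pair is an open condition: if (k + 2)
  * r' is at most \<epsilon>, a pair within r' of it cannot succeed with tolerance r', by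
  \<open>near_perturb\<close>. So r' serves as radius and as margin. Twice \<sigma> being at most r
  keeps the new ball inside the old one.\<close>

lemma shrink_ball:
  assumes c: "\<And>n. g n \<in> carrier (G n)" "\<And>n. x n \<in> carrier (G n)"
    and \<sigma>: "of_nat 2 * \<sigma> \<le> r" "\<sigma> > 0" and \<epsilon>: "\<epsilon> > 0"
    and bad: "\<not> (\<forall>\<^sub>F n in \<U>. \<forall>g' x'. (g', x') \<in> cball2 (g, x, \<sigma>) n \<longrightarrow> M.near n k k \<epsilon> g' x')"
  obtains g' x' r' where "\<And>n. g' n \<in> carrier (G n)" "\<And>n. x' n \<in> carrier (G n)" "r' > 0"
    "\<forall>\<^sub>F n in \<U>. cball2 (g', x', r') n \<subseteq> cball2 (g, x, r) n"
    "\<forall>\<^sub>F n in \<U>. \<forall>y z. (y, z) \<in> cball2 (g', x', r') n \<longrightarrow> \<not> M.near n k k r' y z"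
proof -
  have "\<forall>\<^sub>F n in \<U>. \<exists>g' \<in> carrier (G n). \<exists>x' \<in> carrier (G n).
      (g', x') \<in> cball2 (g, x, \<sigma>) n \<and> \<not> M.near n k k \<epsilon> g' x'"
    using bad unfolding not_eventually_iff by (auto simp: mem_cball2 elim!: eventually_mono)
  then obtain g' x' where gx: "\<And>n. g' n \<in> carrier (G n)" "\<And>n. x' n \<in> carrier (G n)"
    and ev: "\<forall>\<^sub>F n in \<U>. (g' n, x' n) \<in> cball2 (g, x, \<sigma>) n \<and> \<not> M.near n k k \<epsilon> (g' n) (x' n)"
    by (rule eventually_choice) blast
  obtain s where s: "s > 0" "s < \<infinity>" "of_nat (k + 2) * s \<le> \<epsilon>"
    using ennreal_small_multiple[OF \<epsilon>] by blast
  define r' where "r' = min s \<sigma>"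
  have "of_nat (k + 2) * r' \<le> of_nat (k + 2) * s"
    by (intro mult_left_mono) (auto simp: r'_def)
  then have r': "r' > 0" "r' < \<infinity>" "of_nat (k + 2) * r' \<le> \<epsilon>" "r' \<le> \<sigma>"
    using s \<sigma> by (auto simp: r'_def min_less_iff_disj intro: order_trans)
  show ?thesis
  proof (rule that[OF gx r'(1)])
    show "\<forall>\<^sub>F n in \<U>. cball2 (g', x', r') n \<subseteq> cball2 (g, x, r) n"
      using ev
    proof eventually_elim
      case (elim n)
      show ?case
      proof clarify
        fix y z assume yz: "(y, z) \<in> cball2 (g', x', r') n"
        have "M.gdist n y (g n) \<le> M.gdist n y (g' n) + M.gdist n (g' n) (g n)"
          "M.gdist n z (x n) \<le> M.gdist n z (x' n) + M.gdist n (x' n) (x n)"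
          using yz c gx by (auto intro!: M.gdist_triangle simp: mem_cball2)
        moreover have "M.gdist n y (g' n) + M.gdist n (g' n) (g n) \<le> \<sigma> + \<sigma>"
          "M.gdist n z (x' n) + M.gdist n (x' n) (x n) \<le> \<sigma> + \<sigma>"
          using yz elim r'(4) by (auto intro!: add_mono simp: mem_cball2)
        moreover have "\<sigma> + \<sigma> \<le> r" using \<sigma> by (simp add: mult_2)
        ultimately show "(y, z) \<in> cball2 (g, x, r) n"
          using yz by (auto simp: mem_cball2)
      qed
    qed
    show "\<forall>\<^sub>F n in \<U>. \<forall>y z. (y, z) \<in> cball2 (g', x', r') n \<longrightarrow> \<not> M.near n k k r' y z"
      using ev
    proof eventually_elim
      case (elim n)
      show ?case
      proof (intro allI impI notI)
        fix y z assume "(y, z) \<in> cball2 (g', x', r') n" and near: "M.near n k k r' y z"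
        then have yz: "y \<in> carrier (G n)" "z \<in> carrier (G n)"
          "M.gdist n y (g' n) \<le> r'" "M.gdist n z (x' n) \<le> r'"
          by (simp_all add: mem_cball2)
        have "M.gdist n (x' n) z \<le> r'" using yz(4) M.gdist_commute[OF yz(2) gx(2)] by simp
        then have "M.near n k k \<epsilon> (g' n) (x' n)"
          by (rule M.near_perturb[OF near yz(1) gx(1) yz(2) gx(2) yz(3) _ order_refl r'(3,2)])
        then show False using elim by blast
      qed
    qed
  qed
qed

text \<open>
  Baire category as a gliding hump: if no ball works, nested balls of pairs are chosen so that the
  \<open>k\<close>-th one avoids, with a margin, the pairs whose second entry is a word of size \<open>k\<close> in the
  first; saturation provides a pair in all of them, which contradicts \<open>words\<close>.
\<close>

lemma words_on_ball:
  assumes words: "\<And>g x. \<lbrakk>fin_seq g; nontriv_seq g; fin_seq x\<rbrakk> \<Longrightarrow>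
      \<exists>K. \<forall>\<epsilon>>0. \<forall>\<^sub>F n in \<U>. M.near n K K \<epsilon> (g n) (x n)"
    and g0: "fin_seq g0" "nontriv_seq g0"
  obtains g x K \<rho> where "fin_seq g" "nontriv_seq g" "fin_seq x" "\<rho> > 0"
    "\<And>\<epsilon>. \<epsilon> > 0 \<Longrightarrow>
      \<forall>\<^sub>F n in \<U>. \<forall>g' x'. (g', x') \<in> cball2 (g, x, \<rho>) n \<longrightarrow> M.near n K K \<epsilon> g' x'"
proof (rule ccontr)
  assume no: "\<not> thesis"
  note result = that
  obtain \<delta> where \<delta>: "\<delta> > 0" "\<forall>\<^sub>F n in \<U>. \<delta> \<le> nrm n (g0 n)"
    using g0(2) by (auto simp: nontriv_seq_def)
  obtain T :: nat where T: "\<forall>\<^sub>F n in \<U>. nrm n (g0 n) \<le> of_nat T"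
    using g0(1) by (auto simp: fin_seq_def)
  \<comment> \<open>With r + r at most \<delta>, first entries of pairs in the initial ball keep
    norm at least r; with r at most 1, their norms stay below T + 1. So every sequence of pairs in
    that ball is subject to \<open>words\<close>.\<close>
  obtain r where r: "r > 0" "r < \<infinity>" "of_nat 2 * r \<le> min \<delta> 1"
    using ennreal_small_multiple[of "min \<delta> 1" 2] \<delta> by auto
  have rr: "r + r \<le> \<delta>" "r + r \<le> 1" using r(3) by (simp_all add: mult_2)
  then have r1: "r \<le> 1" by (meson le_iff_add order_trans)
  define s0 where "s0 = (g0, \<lambda>n. \<one>\<^bsub>G n\<^esub>, r)"
  have start: "fin_seq g \<and> nontriv_seq g \<and> fin_seq x"
    if c: "\<And>n. g n \<in> carrier (G n)" "\<And>n. x n \<in> carrier (G n)"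
      and ev: "\<forall>\<^sub>F n in \<U>. (g n, x n) \<in> cball2 s0 n" for g x
  proof -
    have "\<forall>\<^sub>F n in \<U>. nrm n (g n) \<le> of_nat (T + 1)"
      using ev T
    proof eventually_elim
      case (elim n)
      have "nrm n (g n) \<le> nrm n (g0 n) + M.gdist n (g n) (g0 n)"
        using c g0 by (intro M.nrm_le_gdist) (auto simp: fin_seq_def)
      also have "\<dots> \<le> of_nat T + 1"
        using elim r1 by (intro add_mono) (auto simp: s0_def mem_cball2)
      finally show ?case by (simp add: add.commute)
    qed
    moreover have "\<forall>\<^sub>F n in \<U>. nrm n (x n) \<le> of_nat 1"
      using ev
    proof eventually_elim
      case (elim n)
      have "nrm n (x n) \<le> nrm n \<one>\<^bsub>G n\<^esub> + M.gdist n (x n) \<one>\<^bsub>G n\<^esub>"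
        using c by (intro M.nrm_le_gdist) auto
      also have "\<dots> \<le> of_nat 1" using elim r1 by (auto simp: s0_def mem_cball2)
      finally show ?case .
    qed
    moreover have "\<forall>\<^sub>F n in \<U>. r \<le> nrm n (g n)"
      using ev \<delta>(2)
    proof eventually_elim
      case (elim n)
      have "r + r \<le> nrm n (g0 n)" using rr elim by simp
      also have "\<dots> \<le> nrm n (g n) + M.gdist n (g0 n) (g n)"
        using c g0 by (intro M.nrm_le_gdist) (auto simp: fin_seq_def)
      also have "M.gdist n (g0 n) (g n) = M.gdist n (g n) (g0 n)"
        using c g0 by (intro M.gdist_commute) (auto simp: fin_seq_def)
      also have "nrm n (g n) + \<dots> \<le> nrm n (g n) + r"
        using elim by (intro add_mono) (auto simp: s0_def mem_cball2)
      finally have "r + r \<le> r + nrm n (g n)" by (simp only: add.commute)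
      then show ?case using r(2) by (auto simp: ennreal_add_left_cancel_le)
    qed
    ultimately show ?thesis
      using c r(1) unfolding fin_seq_def nontriv_seq_def by blast
  qed
  define inv_st where "inv_st = (\<lambda>(g, x, r). (\<forall>n. g n \<in> carrier (G n)) \<and> (\<forall>n. x n \<in> carrier (G n)) \<and>
    (r::ennreal) > 0 \<and> (\<forall>\<^sub>F n in \<U>. cball2 (g, x, r) n \<subseteq> cball2 s0 n))"
  \<comment> \<open>The margin is the radius of the new ball, recorded in the third component of the
    state.\<close>
  define step where "step k s s' \<longleftrightarrow> (\<forall>\<^sub>F n in \<U>. cball2 s' n \<subseteq> cball2 s n) \<and>
    (\<forall>\<^sub>F n in \<U>. \<forall>y z. (y, z) \<in> cball2 s' n \<longrightarrow> \<not> M.near n k k (snd (snd s')) y z)" for k s s'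
  have centre: "(g n, x n) \<in> cball2 (g, x, \<rho>) n" if "inv_st (g, x, \<rho>)" for g x \<rho> n
    using that by (auto simp: inv_st_def mem_cball2)
  have "\<exists>s'. inv_st s' \<and> step k s s'" if s: "inv_st s" for k s
  proof -
    obtain g x \<rho> where s_eq: "s = (g, x, \<rho>)" by (cases s)
    have c: "\<And>n. g n \<in> carrier (G n)" "\<And>n. x n \<in> carrier (G n)" "\<rho> > 0"
      and sub: "\<forall>\<^sub>F n in \<U>. cball2 (g, x, \<rho>) n \<subseteq> cball2 s0 n"
      using s by (auto simp: s_eq inv_st_def)
    obtain \<sigma> where \<sigma>: "\<sigma> > 0" "of_nat 2 * \<sigma> \<le> \<rho>"
      using ennreal_small_multiple[OF c(3), of 2] by blast
    have "\<forall>\<^sub>F n in \<U>. (g n, x n) \<in> cball2 s0 n"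
      using sub by eventually_elim (use centre s s_eq in blast)
    then have fin: "fin_seq g" "nontriv_seq g" "fin_seq x" using start[OF c(1,2)] by auto
    \<comment> \<open>Otherwise the ball of radius \<sigma> around the current centre, with constant
      k, would be the one sought.\<close>
    obtain \<epsilon> where \<epsilon>: "\<epsilon> > 0"
      "\<not> (\<forall>\<^sub>F n in \<U>. \<forall>g' x'. (g', x') \<in> cball2 (g, x, \<sigma>) n \<longrightarrow> M.near n k k \<epsilon> g' x')"
      using no result[OF fin \<sigma>(1), of k] by blast
    obtain g' x' r' where s': "\<And>n. g' n \<in> carrier (G n)" "\<And>n. x' n \<in> carrier (G n)" "r' > 0"
      "\<forall>\<^sub>F n in \<U>. cball2 (g', x', r') n \<subseteq> cball2 (g, x, \<rho>) n"
      "\<forall>\<^sub>F n in \<U>. \<forall>y z. (y, z) \<in> cball2 (g', x', r') n \<longrightarrow> \<not> M.near n k k r' y z"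
      by (rule shrink_ball[OF c(1,2) \<sigma>(2,1) \<epsilon>]) blast
    have "\<forall>\<^sub>F n in \<U>. cball2 (g', x', r') n \<subseteq> cball2 s0 n"
      using s'(4) sub by eventually_elim blast
    then have "inv_st (g', x', r') \<and> step k s (g', x', r')"
      using s' by (auto simp: inv_st_def step_def s_eq)
    then show ?thesis by blast
  qed
  moreover have "inv_st s0"
    using r g0 by (auto simp: inv_st_def s0_def fin_seq_def)
  ultimately obtain f where f: "\<And>k. inv_st (f k)" "\<And>k. step k (f k) (f (Suc k))"
    using dependent_nat_choice[of "\<lambda>_. inv_st" "\<lambda>k s s'. step k s s'"] by blast
  have "\<forall>\<^sub>F n in \<U>. (carrier (G n) \<times> carrier (G n)) \<inter> (\<Inter>j\<le>k. cball2 (f j) n) \<noteq> {}" for k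
  proof -
    have "\<forall>\<^sub>F n in \<U>. \<forall>j\<in>{..<k}. cball2 (f (Suc j)) n \<subseteq> cball2 (f j) n"
      using f(2) by (intro eventually_ball_finite) (auto simp: step_def)
    then show ?thesis
    proof eventually_elim
      case (elim n)
      have sub: "cball2 (f k) n \<subseteq> cball2 (f j) n" if "j \<le> k" for j
        using that
      proof (induction rule: inc_induct)
        case (step m)
        then show ?case using elim by (metis lessThan_iff order_trans)
      qed auto
      obtain g x \<rho> where fk: "f k = (g, x, \<rho>)" by (cases "f k")
      have "(g n, x n) \<in> cball2 (f k) n" using centre f(1)[of k] fk by auto
      moreover have "(g n, x n) \<in> carrier (G n) \<times> carrier (G n)"
        using f(1)[of k] fk by (auto simp: inv_st_def)
      ultimately show ?case using sub by blast
    qed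
  qed
  moreover have "carrier (G n) \<times> carrier (G n) \<noteq> {}" for n
    using M.one_closed by blast
  ultimately obtain z where z: "\<And>n. z n \<in> carrier (G n) \<times> carrier (G n)"
      "\<And>k. \<forall>\<^sub>F n in \<U>. z n \<in> cball2 (f k) n"
    using ultrafilter_saturation[OF nonprincipal, of "\<lambda>n. carrier (G n) \<times> carrier (G n)"
        "\<lambda>k. cball2 (f k)"] by auto
  define g x where "g n = fst (z n)" and "x n = snd (z n)" for n
  have z_eq: "z n = (g n, x n)" for n by (simp add: g_def x_def)
  have c: "g n \<in> carrier (G n)" "x n \<in> carrier (G n)" for n
    using z(1)[of n] by (auto simp: z_eq)
  have "\<forall>\<^sub>F n in \<U>. cball2 (f 0) n \<subseteq> cball2 s0 n"
    using f(1)[of 0] by (auto simp: inv_st_def split: prod.splits)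
  then have "\<forall>\<^sub>F n in \<U>. (g n, x n) \<in> cball2 s0 n"
    using z(2)[of 0] by eventually_elim (auto simp: z_eq)
  then obtain K where K: "\<And>\<epsilon>. \<epsilon> > 0 \<Longrightarrow> \<forall>\<^sub>F n in \<U>. M.near n K K \<epsilon> (g n) (x n)"
    using start[OF c] words by blast
  \<comment> \<open>Size K is excluded by step K, whose result is ball number \<open>Suc K\<close>;
    its radius is the tolerance at which \<open>K\<close> is contradicted.\<close>
  have "snd (snd (f (Suc K))) > 0" using f(1)[of "Suc K"] by (auto simp: inv_st_def split: prod.splits)
  note K[OF this]
  moreover have "\<forall>\<^sub>F n in \<U>. \<forall>y z. (y, z) \<in> cball2 (f (Suc K)) n \<longrightarrow>
      \<not> M.near n K K (snd (snd (f (Suc K)))) y z"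
    using f(2)[of K] by (simp add: step_def)
  ultimately have "\<forall>\<^sub>F n in \<U>. False"
    using z(2)[of "Suc K"] by eventually_elim (auto simp: z_eq)
  then show False using not_bot by auto
qed

section \<open>Bounds uniform on shells\<close>

definition shell :: "ennreal \<Rightarrow> nat \<Rightarrow> nat \<Rightarrow> 'a set"
  where "shell \<delta> t n = {h \<in> carrier (G n). \<delta> \<le> nrm n h \<and> nrm n h \<le> of_nat t}"

lemma shell_seq:
  assumes "\<And>n. h n \<in> carrier (G n)" "\<forall>\<^sub>F n in \<U>. h n \<in> shell \<delta> t n" "\<delta> > 0"
  shows "fin_seq h" "nontriv_seq h"
proof -
  have "\<forall>\<^sub>F n in \<U>. nrm n (h n) \<le> of_nat t" "\<forall>\<^sub>F n in \<U>. \<delta> \<le> nrm n (h n)"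
    using assms(2) by (auto simp: shell_def elim!: eventually_mono)
  then show "fin_seq h" "nontriv_seq h"
    using assms(1,3) unfolding fin_seq_def nontriv_seq_def by blast+
qed

context
  assumes words: "\<And>g x. \<lbrakk>fin_seq g; nontriv_seq g; fin_seq x\<rbrakk> \<Longrightarrow>
      \<exists>K. \<forall>\<epsilon>>0. \<forall>\<^sub>F n in \<U>. M.near n K K \<epsilon> (g n) (x n)"
begin

text \<open>This is what saturation alone gives: K depends on the tolerance \<rho>. It is used only
  at tolerances fixed in advance.\<close>

lemma near_shell:
  assumes "\<delta> > 0" "\<rho> > 0"
  shows "\<exists>K. \<forall>\<^sub>F n in \<U>. \<forall>h \<in> shell \<delta> t n. \<forall>x \<in> carrier (G n). nrm n x \<le> of_nat T \<longrightarrow> M.near n K K \<rho> h x"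
proof -
  have "\<exists>K. \<forall>\<^sub>F n in \<U>. \<forall>h \<in> shell \<delta> t n. \<forall>x \<in> carrier (G n). nrm n x \<le> of_nat T \<longrightarrow> M.near n (id K) K \<rho> h x"
  proof (rule near_uniform)
    show "\<exists>K. \<forall>\<epsilon>>0. \<forall>\<^sub>F n in \<U>. M.near n (id K) K \<epsilon> (h n) (x n)"
      if "\<And>n. h n \<in> carrier (G n)" "\<forall>\<^sub>F n in \<U>. h n \<in> shell \<delta> t n" "fin_seq x" for h x
      using words[OF shell_seq[OF that(1,2) assms(1)] that(3)] by simp
  qed (use assms in \<open>auto simp: shell_def mono_def\<close>)
  then show ?thesis by simp
qed

text \<open>
  Any \<open>h\<close> in the shell yields a word near the centre \<open>g\<close> of the ball of \<open>words_on_ball\<close>, and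
  quotients of two words in it fill the \<open>\<rho>\<close>-ball around the identity; hence approximating
  \<open>x\<close> up to the fixed radius \<open>\<rho>\<close> is enough.
\<close>

lemma near_bootstrap:
  assumes g0: "fin_seq g0" "nontriv_seq g0" and \<delta>: "\<delta> > 0"
  obtains L \<rho> where "\<rho> > 0"
    "\<And>N T K. \<forall>\<^sub>F n in \<U>. \<forall>h \<in> shell \<delta> t n. \<forall>x \<in> carrier (G n). nrm n x \<le> of_nat T \<longrightarrow> M.near n N K \<rho> h x \<Longrightarrow>
      \<exists>K. \<forall>\<epsilon>>0. \<forall>\<^sub>F n in \<U>. \<forall>h \<in> shell \<delta> t n. \<forall>x \<in> carrier (G n).
        nrm n x \<le> of_nat T \<longrightarrow> M.near n (L + N) K \<epsilon> h x"
proof -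
  obtain g x0 k \<rho> where g: "fin_seq g" "nontriv_seq g" and x0: "fin_seq x0" and \<rho>: "\<rho> > 0"
    and ball: "\<And>\<epsilon>. \<epsilon> > 0 \<Longrightarrow>
      \<forall>\<^sub>F n in \<U>. \<forall>g' x'. (g', x') \<in> cball2 (g, x0, \<rho>) n \<longrightarrow> M.near n k k \<epsilon> g' x'"
    by (rule words_on_ball[OF words g0]) blast+
  obtain T0 :: nat where T0: "\<forall>\<^sub>F n in \<U>. nrm n (g n) \<le> of_nat T0"
    using g by (auto simp: fin_seq_def)
  obtain m where m: "\<forall>\<^sub>F n in \<U>. \<forall>h \<in> shell \<delta> t n. \<forall>x \<in> carrier (G n).
      nrm n x \<le> of_nat T0 \<longrightarrow> M.near n m m \<rho> h x"
    using near_shell[OF \<delta> \<rho>] by blast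
  show ?thesis
  \<comment> \<open>Two words of length k in a base \<open>g'\<close>, which is itself a word of
    length m in h. Both k and m are fixed before N, T, K and \<epsilon>.\<close>
  proof (rule that[OF \<rho>, where L = "(k + k) * m"])
    fix N T K
    assume near: "\<forall>\<^sub>F n in \<U>. \<forall>h \<in> shell \<delta> t n. \<forall>x \<in> carrier (G n). nrm n x \<le> of_nat T \<longrightarrow> M.near n N K \<rho> h x"
    have "\<forall>\<^sub>F n in \<U>. \<forall>h \<in> shell \<delta> t n. \<forall>x \<in> carrier (G n).
        nrm n x \<le> of_nat T \<longrightarrow> M.near n ((k + k) * m + N) (k + m + K) \<epsilon> h x"
      if \<epsilon>: "\<epsilon> > 0" for \<epsilon>
    proof -
      obtain \<epsilon>' where \<epsilon>': "\<epsilon>' > 0" "of_nat 2 * \<epsilon>' \<le> \<epsilon>"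
        using ennreal_small_multiple[OF \<epsilon>, of 2] by blast
      show ?thesis
        using near m T0 ball[OF \<epsilon>'(1)]
      proof eventually_elim
        case (elim n)
        have gc: "g n \<in> carrier (G n)" "x0 n \<in> carrier (G n)"
          using g x0 by (auto simp: fin_seq_def)
        show ?case
        proof (intro ballI impI)
          fix h x assume h: "h \<in> shell \<delta> t n" and x: "x \<in> carrier (G n)" "nrm n x \<le> of_nat T"
          have hc: "h \<in> carrier (G n)" using h by (simp add: shell_def)
          have "M.near n m m \<rho> h (g n)" using h elim(2,3) gc by blast
          then obtain g' where g': "g' \<in> conj_words (G n) (M.nball n m) h m" "M.gdist n (g n) g' < \<rho>"
            by (auto simp: M.near_def)
          have g'c: "g' \<in> carrier (G n)"
            using g' M.conj_words_closed[OF M.nball_closed hc] by blast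
          show "M.near n ((k + k) * m + N) (k + m + K) \<epsilon> h x"
          proof (rule M.near_through[OF hc g'(1) x(1) _ gc(2) _ \<epsilon>'(2)])
            show "M.near n N K \<rho> h x" using elim(1) h x by blast
            fix z assume z: "z \<in> carrier (G n)" "M.gdist n z (x0 n) \<le> \<rho>"
            have "M.gdist n g' (g n) \<le> \<rho>"
              using M.gdist_commute[OF g'c gc(1)] g'(2) by simp
            \<comment> \<open>Here the category argument has to be about pairs: h reaches the centre
              g only up to \<rho>, and the word \<open>g'\<close> reached instead must still have
              the short approximations.\<close>
            then have "(g', z) \<in> cball2 (g, x0, \<rho>) n" using z g'c by (simp add: mem_cball2)
            then show "M.near n k k \<epsilon>' g' z" using elim(4) by blast
          qed
        qed
      qed
    qed
    then show "\<exists>K. \<forall>\<epsilon>>0. \<forall>\<^sub>F n in \<U>. \<forall>h \<in> shell \<delta> t n. \<forall>x \<in> carrier (G n).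
        nrm n x \<le> of_nat T \<longrightarrow> M.near n ((k + k) * m + N) K \<epsilon> h x"
      by blast
  qed
qed

text \<open>For bounded simplicity the number of factors must not depend on the norm of \<open>x\<close>; passing through
  one fixed \<open>g\<close> achieves this.\<close>

lemma near_bounded:
  assumes g: "fin_seq g"
    and N: "\<And>x. fin_seq x \<Longrightarrow> \<exists>K. \<forall>\<epsilon>>0. \<forall>\<^sub>F n in \<U>. M.near n N K \<epsilon> (g n) (x n)"
    and pos: "\<delta> > 0" "\<rho> > 0"
  shows "\<exists>L. \<forall>T. \<exists>K. \<forall>\<^sub>F n in \<U>. \<forall>h \<in> shell \<delta> t n. \<forall>x \<in> carrier (G n).
    nrm n x \<le> of_nat T \<longrightarrow> M.near n L K \<rho> h x"
proof -
  have gc: "g n \<in> carrier (G n)" for n using g by (auto simp: fin_seq_def)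
  \<comment> \<open>Replacing the base g by a word within \<sigma> of it, at tolerance \<sigma>,
    costs at most N + 2 times \<sigma> by \<open>near_perturb\<close>.\<close>
  obtain \<sigma> where \<sigma>: "\<sigma> > 0" "\<sigma> < \<infinity>" "of_nat (N + 2) * \<sigma> \<le> \<rho>"
    using ennreal_small_multiple[OF pos(2)] by blast
  obtain T0 :: nat where T0: "\<forall>\<^sub>F n in \<U>. nrm n (g n) \<le> of_nat T0"
    using g by (auto simp: fin_seq_def)
  obtain m where m: "\<forall>\<^sub>F n in \<U>. \<forall>h \<in> shell \<delta> t n. \<forall>x \<in> carrier (G n).
      nrm n x \<le> of_nat T0 \<longrightarrow> M.near n m m \<sigma> h x"
    using near_shell[OF pos(1) \<sigma>(1)] by blast
  have "\<exists>K. \<forall>\<^sub>F n in \<U>. \<forall>h \<in> shell \<delta> t n. \<forall>x \<in> carrier (G n).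
      nrm n x \<le> of_nat T \<longrightarrow> M.near n (N * m) K \<rho> h x" for T
  proof -
    \<comment> \<open>For the single base g the length N is known and only the conjugator bound K
      depends on T. As m was chosen from the norm of g and \<sigma>, the final length N * m does not
      depend on T.\<close>
    have "\<exists>K. \<forall>\<^sub>F n in \<U>. \<forall>h \<in> {g n}. \<forall>x \<in> carrier (G n). nrm n x \<le> of_nat T \<longrightarrow> M.near n N K \<sigma> h x"
    proof (rule near_uniform[where f = "\<lambda>_. N"])
      show "\<exists>K. \<forall>\<epsilon>>0. \<forall>\<^sub>F n in \<U>. M.near n N K \<epsilon> (h n) (x n)"
        if h: "\<forall>\<^sub>F n in \<U>. h n \<in> {g n}" and x: "fin_seq x" for h x
      proof -
        obtain K where K: "\<And>\<epsilon>. \<epsilon> > 0 \<Longrightarrow> \<forall>\<^sub>F n in \<U>. M.near n N K \<epsilon> (g n) (x n)"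
          using N[OF x] by blast
        have "\<forall>\<^sub>F n in \<U>. M.near n N K \<epsilon> (h n) (x n)" if "\<epsilon> > 0" for \<epsilon>
          using K[OF that] h by eventually_elim simp
        then show ?thesis by blast
      qed
    qed (use gc \<sigma> in \<open>auto simp: mono_def\<close>)
    then obtain K where K: "\<forall>\<^sub>F n in \<U>. \<forall>x \<in> carrier (G n). nrm n x \<le> of_nat T \<longrightarrow> M.near n N K \<sigma> (g n) x"
      by auto
    have "\<forall>\<^sub>F n in \<U>. \<forall>h \<in> shell \<delta> t n. \<forall>x \<in> carrier (G n).
        nrm n x \<le> of_nat T \<longrightarrow> M.near n (N * m) (K + m) \<rho> h x"
      using K m T0
    proof eventually_elim
      case (elim n)
      show ?case
      proof (intro ballI impI)
        fix h x assume h: "h \<in> shell \<delta> t n" and x: "x \<in> carrier (G n)" "nrm n x \<le> of_nat T"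
        have hc: "h \<in> carrier (G n)" using h by (simp add: shell_def)
        have "M.near n m m \<sigma> h (g n)" using h elim(2,3) gc by blast
        then obtain g' where g': "g' \<in> conj_words (G n) (M.nball n m) h m" "M.gdist n (g n) g' < \<sigma>"
          by (auto simp: M.near_def)
        have g'c: "g' \<in> carrier (G n)"
          using g' M.conj_words_closed[OF M.nball_closed hc] by blast
        have "M.near n N K \<rho> g' x"
        proof (rule M.near_perturb[OF _ gc g'c x(1) x(1)])
          show "M.near n N K \<sigma> (g n) x" using elim(1) x by blast
          show "M.gdist n (g n) g' \<le> \<sigma>" using g'(2) by simp
        qed (use \<sigma> x in auto)
        then show "M.near n (N * m) (K + m) \<rho> h x" by (rule M.near_comp[OF hc g'(1)])
      qed
    qed
    then show ?thesis by blast
  qed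
  then show ?thesis by blast
qed

end

section \<open>Words in the finitary ultraproduct\<close>

abbreviation prodG :: "(nat \<Rightarrow> 'a) monoid"
  where "prodG \<equiv> product_group UNIV G"

abbreviation Fin :: "(nat \<Rightarrow> 'a) set monoid"
  where "Fin \<equiv> met_ultraproduct_fin \<U> G nrm"

definition cls :: "(nat \<Rightarrow> 'a) \<Rightarrow> (nat \<Rightarrow> 'a) set"
  where "cls x = met_null \<U> G nrm #>\<^bsub>prodG\<^esub> x"

lemma prodG_group: "group prodG"
  by (rule product_group) (rule M.is_group)

lemma null_normal: "met_null \<U> G nrm \<lhd> prodG"
  by (rule normal_met_null[OF ultra metric_group])

lemma null_subgroup: "subgroup (met_null \<U> G nrm) prodG"
  by (rule normal_imp_subgroup[OF null_normal])

lemma tendsto_0_ennreal_iff: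
  fixes f :: "nat \<Rightarrow> ennreal"
  shows "(f \<longlongrightarrow> 0) \<U> \<longleftrightarrow> (\<forall>\<epsilon>>0. \<forall>\<^sub>F n in \<U>. f n < \<epsilon>)"
  by (auto simp: order_tendsto_iff)

lemma mem_cls:
  assumes "\<And>n. x n \<in> carrier (G n)" "\<And>n. y n \<in> carrier (G n)"
  shows "x \<in> cls y \<longleftrightarrow> (\<forall>\<epsilon>>0. \<forall>\<^sub>F n in \<U>. M.gdist n (x n) (y n) < \<epsilon>)"
proof -
  have c: "x \<in> carrier prodG" "y \<in> carrier prodG" using assms by auto
  have "x \<in> cls y \<longleftrightarrow> x \<otimes>\<^bsub>prodG\<^esub> inv\<^bsub>prodG\<^esub> y \<in> met_null \<U> G nrm"
    unfolding cls_def by (rule subgroup.rcos_module[OF null_subgroup prodG_group c(2,1)])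
  also have "x \<otimes>\<^bsub>prodG\<^esub> inv\<^bsub>prodG\<^esub> y = (\<lambda>n. x n \<otimes>\<^bsub>G n\<^esub> inv\<^bsub>G n\<^esub> y n)"
    using product_group_inv[OF ultra metric_group c(2)] by (auto simp: fun_eq_iff)
  finally show ?thesis
    using assms by (auto simp: met_null_def tendsto_0_ennreal_iff M.gdist_def)
qed

lemma cls_self: "(\<And>n. x n \<in> carrier (G n)) \<Longrightarrow> x \<in> cls x"
  by (subst mem_cls) auto

lemma cls_eq_iff:
  assumes "\<And>n. x n \<in> carrier (G n)" "\<And>n. y n \<in> carrier (G n)"
  shows "cls x = cls y \<longleftrightarrow> (\<forall>\<epsilon>>0. \<forall>\<^sub>F n in \<U>. M.gdist n (x n) (y n) < \<epsilon>)"
proof -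
  have "cls x = cls y \<longleftrightarrow> x \<in> cls y"
  proof
    assume "x \<in> cls y"
    then show "cls x = cls y"
      using group.repr_independence[OF prodG_group, of x "met_null \<U> G nrm" y] null_subgroup assms
      by (simp add: cls_def PiE_UNIV_domain)
  qed (use cls_self[OF assms(1)] in blast)
  then show ?thesis using mem_cls[OF assms] by simp
qed

lemma cls_mult:
  assumes "\<And>n. x n \<in> carrier (G n)" "\<And>n. y n \<in> carrier (G n)"
  shows "cls x \<otimes>\<^bsub>Fin\<^esub> cls y = cls (\<lambda>n. x n \<otimes>\<^bsub>G n\<^esub> y n)"
  using normal.rcos_sum[OF null_normal, of x y] assms
  by (simp add: cls_def met_ultraproduct_fin_def met_ultraproduct_def PiE_UNIV_domain restrict_UNIV)

lemma fin_seq_one: "fin_seq (\<lambda>n. \<one>\<^bsub>G n\<^esub>)"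
  by (simp add: fin_seq_def)

lemma fin_seq_mult:
  assumes "fin_seq x" "fin_seq y"
  shows "fin_seq (\<lambda>n. x n \<otimes>\<^bsub>G n\<^esub> y n)"
proof -
  have c: "x n \<in> carrier (G n)" "y n \<in> carrier (G n)" for n
    using assms by (auto simp: fin_seq_def)
  obtain S T :: nat where "\<forall>\<^sub>F n in \<U>. nrm n (x n) \<le> of_nat S" "\<forall>\<^sub>F n in \<U>. nrm n (y n) \<le> of_nat T"
    using assms by (auto simp: fin_seq_def)
  then have "\<forall>\<^sub>F n in \<U>. nrm n (x n \<otimes>\<^bsub>G n\<^esub> y n) \<le> of_nat (S + T)"
    by eventually_elim (auto intro!: order_trans[OF M.nrm_mult_le] add_mono c)
  then show ?thesis using c unfolding fin_seq_def by blast
qed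

lemma fin_seq_inv: "fin_seq x \<Longrightarrow> fin_seq (\<lambda>n. inv\<^bsub>G n\<^esub> x n)"
  by (simp add: fin_seq_def M.nrm_inv)

text \<open>Norms have a limit along \<U>, and it is finite exactly when some natural number bounds
  them for \<U>-many n.\<close>

lemma carrier_Fin: "carrier Fin = cls ` Collect fin_seq"
proof -
  have car: "carrier (met_ultraproduct \<U> G nrm) = cls ` {x. \<forall>n. x n \<in> carrier (G n)}"
    by (auto simp: met_ultraproduct_def carrier_FactGroup cls_def PiE_UNIV_domain)
  have "met_ultraproduct_nrm \<U> nrm (cls x) < \<infinity> \<longleftrightarrow> fin_seq x" if x: "\<And>n. x n \<in> carrier (G n)" for x
  proof -
    let ?l = "met_ultraproduct_nrm \<U> nrm (cls x)"
    have lim: "((\<lambda>n. nrm n (x n)) \<longlongrightarrow> ?l) \<U>"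
      using x cls_self[OF x] by (intro met_ultraproduct_nrm_eq[OF ultra metric_group]) (auto simp: car)
    show ?thesis
    proof
      assume "?l < \<infinity>"
      then obtain T :: nat where "?l < of_nat T" using ennreal_Ex_less_of_nat by auto
      then have "\<forall>\<^sub>F n in \<U>. nrm n (x n) < of_nat T" by (rule order_tendstoD(2)[OF lim])
      then have "\<forall>\<^sub>F n in \<U>. nrm n (x n) \<le> of_nat T" by (rule eventually_mono) simp
      then show "fin_seq x" using x unfolding fin_seq_def by blast
    next
      assume "fin_seq x"
      then obtain T :: nat where "\<forall>\<^sub>F n in \<U>. nrm n (x n) \<le> of_nat T" by (auto simp: fin_seq_def)
      then have "?l \<le> of_nat T" by (intro tendsto_upperbound[OF lim _ not_bot])
      also have "\<dots> < \<infinity>" by (simp add: of_nat_less_top)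
      finally show "?l < \<infinity>" .
    qed
  qed
  then show ?thesis
    by (auto simp: met_ultraproduct_fin_def car fin_seq_def)
qed

lemma one_Fin: "\<one>\<^bsub>Fin\<^esub> = cls (\<lambda>n. \<one>\<^bsub>G n\<^esub>)"
proof -
  have "\<one>\<^bsub>Fin\<^esub> = met_null \<U> G nrm" by (simp add: met_ultraproduct_fin_def met_ultraproduct_def)
  also have "\<dots> = met_null \<U> G nrm #>\<^bsub>prodG\<^esub> \<one>\<^bsub>prodG\<^esub>"
    using group.coset_mult_one[OF prodG_group subgroup.subset[OF null_subgroup]] by simp
  finally show ?thesis by (simp add: cls_def restrict_UNIV)
qed

lemma cls_closed: "fin_seq x \<Longrightarrow> cls x \<in> carrier Fin"
  by (simp add: carrier_Fin)

lemma cls_inv_mult: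
  "fin_seq x \<Longrightarrow> cls (\<lambda>n. inv\<^bsub>G n\<^esub> x n) \<otimes>\<^bsub>Fin\<^esub> cls x = \<one>\<^bsub>Fin\<^esub>"
  by (subst cls_mult) (auto simp: one_Fin fin_seq_carrier)

lemma group_Fin: "group Fin"
proof (rule groupI)
  fix X Y assume "X \<in> carrier Fin" "Y \<in> carrier Fin"
  then show "X \<otimes>\<^bsub>Fin\<^esub> Y \<in> carrier Fin"
    by (auto simp: carrier_Fin cls_mult fin_seq_carrier intro!: imageI fin_seq_mult)
next
  show "\<one>\<^bsub>Fin\<^esub> \<in> carrier Fin" using cls_closed[OF fin_seq_one] by (simp add: one_Fin)
next
  fix X Y Z assume "X \<in> carrier Fin" "Y \<in> carrier Fin" "Z \<in> carrier Fin"
  then show "X \<otimes>\<^bsub>Fin\<^esub> Y \<otimes>\<^bsub>Fin\<^esub> Z = X \<otimes>\<^bsub>Fin\<^esub> (Y \<otimes>\<^bsub>Fin\<^esub> Z)"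
    by (auto simp: carrier_Fin cls_mult fin_seq_carrier M.m_assoc)
next
  fix X assume "X \<in> carrier Fin"
  then show "\<one>\<^bsub>Fin\<^esub> \<otimes>\<^bsub>Fin\<^esub> X = X"
    by (auto simp: carrier_Fin cls_mult one_Fin fin_seq_carrier)
next
  fix X assume "X \<in> carrier Fin"
  then show "\<exists>Y \<in> carrier Fin. Y \<otimes>\<^bsub>Fin\<^esub> X = \<one>\<^bsub>Fin\<^esub>"
    using cls_inv_mult cls_closed fin_seq_inv by (auto simp: carrier_Fin)
qed

lemma cls_inv: "fin_seq x \<Longrightarrow> inv\<^bsub>Fin\<^esub> (cls x) = cls (\<lambda>n. inv\<^bsub>G n\<^esub> x n)"
  by (rule group.inv_equality[OF group_Fin cls_inv_mult cls_closed cls_closed[OF fin_seq_inv]])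

lemma cls_nontrivial_iff:
  assumes "fin_seq g"
  shows "cls g \<noteq> \<one>\<^bsub>Fin\<^esub> \<longleftrightarrow> nontriv_seq g"
  using assms unfolding one_Fin
  by (subst cls_eq_iff) (auto simp: fin_seq_carrier M.gdist_def nontriv_seq_def not_eventually_iff not_less)

lemma cls_conj:
  assumes "fin_seq c" "fin_seq s"
  shows "cls c \<otimes>\<^bsub>Fin\<^esub> cls s \<otimes>\<^bsub>Fin\<^esub> inv\<^bsub>Fin\<^esub> cls c = cls (\<lambda>n. c n \<otimes>\<^bsub>G n\<^esub> s n \<otimes>\<^bsub>G n\<^esub> inv\<^bsub>G n\<^esub> c n)"
  using assms by (simp add: cls_inv cls_mult fin_seq_carrier)

section \<open>Words of classes and words of representatives\<close>

lemma conj_gens_lift: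
  assumes g: "fin_seq g" and Y: "Y \<in> conj_gens Fin (carrier Fin) (cls g)"
  shows "\<exists>y K. fin_seq y \<and> cls y = Y \<and> (\<forall>\<^sub>F n in \<U>. y n \<in> conj_gens (G n) (M.nball n K) (g n))"
proof (cases "Y = \<one>\<^bsub>Fin\<^esub>")
  case True
  then show ?thesis
    using fin_seq_one by (auto simp: one_Fin conj_gens_def intro!: exI[of _ "\<lambda>n. \<one>\<^bsub>G n\<^esub>"])
next
  case False
  then obtain c S where c: "fin_seq c" and S: "S \<in> {cls g, inv\<^bsub>Fin\<^esub> cls g}"
    and Y: "Y = cls c \<otimes>\<^bsub>Fin\<^esub> S \<otimes>\<^bsub>Fin\<^esub> inv\<^bsub>Fin\<^esub> cls c"
    using Y by (auto simp: conj_gens_def carrier_Fin)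
  obtain s where s: "fin_seq s" "S = cls s" "\<And>n. s n \<in> {g n, inv\<^bsub>G n\<^esub> g n}"
    using S g fin_seq_inv cls_inv by fastforce
  obtain K :: nat where K: "\<forall>\<^sub>F n in \<U>. nrm n (c n) \<le> of_nat K" using c by (auto simp: fin_seq_def)
  let ?y = "\<lambda>n. c n \<otimes>\<^bsub>G n\<^esub> s n \<otimes>\<^bsub>G n\<^esub> inv\<^bsub>G n\<^esub> c n"
  have "\<forall>\<^sub>F n in \<U>. ?y n \<in> conj_gens (G n) (M.nball n K) (g n)"
    using K
  proof eventually_elim
    case (elim n)
    then have "c n \<in> M.nball n K" using c by (simp add: M.nball_def fin_seq_carrier)
    then show ?case using s(3)[of n] unfolding conj_gens_def by blast
  qed
  moreover have "fin_seq ?y" using c s by (intro fin_seq_mult fin_seq_inv)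
  moreover have "cls ?y = Y" unfolding Y s(2) using cls_conj[OF c s(1)] by simp
  ultimately show ?thesis by blast
qed

text \<open>A word has finitely many conjugators, each represented by a sequence of bounded norm, so
  one K bounds them all.\<close>

lemma conj_words_lift:
  assumes g: "fin_seq g" and "W \<in> conj_words Fin (carrier Fin) (cls g) L"
  shows "\<exists>w K. fin_seq w \<and> cls w = W \<and> (\<forall>\<^sub>F n in \<U>. w n \<in> conj_words (G n) (M.nball n K) (g n) L)"
  using assms(2)
proof (induction L arbitrary: W)
  case 0
  then show ?case
    using fin_seq_one by (auto simp: one_Fin intro!: exI[of _ "\<lambda>n. \<one>\<^bsub>G n\<^esub>"])
next
  case (Suc L)
  then obtain Y U where YU: "Y \<in> conj_gens Fin (carrier Fin) (cls g)"
    "U \<in> conj_words Fin (carrier Fin) (cls g) L" "W = Y \<otimes>\<^bsub>Fin\<^esub> U"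
    by auto
  obtain y K where y: "fin_seq y" "cls y = Y"
    "\<forall>\<^sub>F n in \<U>. y n \<in> conj_gens (G n) (M.nball n K) (g n)"
    using conj_gens_lift[OF g YU(1)] by blast
  obtain u K' where u: "fin_seq u" "cls u = U"
    "\<forall>\<^sub>F n in \<U>. u n \<in> conj_words (G n) (M.nball n K') (g n) L"
    using Suc.IH[OF YU(2)] by blast
  have "\<forall>\<^sub>F n in \<U>. y n \<otimes>\<^bsub>G n\<^esub> u n \<in> conj_words (G n) (M.nball n (K + K')) (g n) (Suc L)"
    using y(3) u(3)
  proof eventually_elim
    case (elim n)
    have "y n \<in> conj_gens (G n) (M.nball n (K + K')) (g n)"
      using elim(1) M.nball_mono[of K "K + K'" n] by (auto simp: conj_gens_def)
    moreover have "u n \<in> conj_words (G n) (M.nball n (K + K')) (g n) L"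
      using elim(2) conj_words_mono[OF M.nball_mono[of K' "K + K'" n]] by auto
    ultimately show ?case by auto
  qed
  moreover have "cls (\<lambda>n. y n \<otimes>\<^bsub>G n\<^esub> u n) = W"
    using cls_mult[of y u] y u YU(3) by (simp add: fin_seq_carrier)
  ultimately show ?case using fin_seq_mult[OF y(1) u(1)] by blast
qed

lemma eventually_cases:
  assumes "\<forall>\<^sub>F n in \<U>. P n \<or> Q n"
  obtains "\<forall>\<^sub>F n in \<U>. P n" | "\<forall>\<^sub>F n in \<U>. Q n"
proof (cases "\<forall>\<^sub>F n in \<U>. P n")
  case False
  then have "\<forall>\<^sub>F n in \<U>. \<not> P n" by (simp add: not_eventually_iff)
  then have "\<forall>\<^sub>F n in \<U>. Q n" using assms by eventually_elim blast
  then show ?thesis using that by blast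
qed (use that in blast)

lemma cls_cong:
  assumes "\<And>n. x n \<in> carrier (G n)" "\<And>n. y n \<in> carrier (G n)" "\<forall>\<^sub>F n in \<U>. x n = y n"
  shows "cls x = cls y"
proof -
  have "\<forall>\<^sub>F n in \<U>. M.gdist n (x n) (y n) < \<epsilon>" if "\<epsilon> > 0" for \<epsilon>
    using assms(3) by eventually_elim (simp add: assms(2) that)
  then show ?thesis using cls_eq_iff[OF assms(1,2)] by blast
qed

lemma fin_seq_cong:
  assumes "fin_seq x" "\<And>n. y n \<in> carrier (G n)" "\<forall>\<^sub>F n in \<U>. y n = x n"
  shows "fin_seq y"
proof -
  obtain T :: nat where T: "\<forall>\<^sub>F n in \<U>. nrm n (x n) \<le> of_nat T" using assms by (auto simp: fin_seq_def)
  have "\<forall>\<^sub>F n in \<U>. nrm n (y n) \<le> of_nat T"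
    using T assms(3) by eventually_elim simp
  then show ?thesis using assms(2) unfolding fin_seq_def by blast
qed

text \<open>Whether a factor is trivial, a conjugate of g or one of its inverse may vary with n, but
  \<U> singles out one of the three cases. The common K makes the chosen conjugators a sequence in
  the finitary subgroup.\<close>

lemma conj_gens_proj:
  assumes g: "fin_seq g" and y: "\<And>n. y n \<in> carrier (G n)"
    "\<forall>\<^sub>F n in \<U>. y n \<in> conj_gens (G n) (M.nball n K) (g n)"
  shows "fin_seq y \<and> cls y \<in> conj_gens Fin (carrier Fin) (cls g)"
proof -
  have conj: ?thesis
    if s: "fin_seq s" "cls s \<in> {cls g, inv\<^bsub>Fin\<^esub> cls g}"
      and ev: "\<forall>\<^sub>F n in \<U>. \<exists>c \<in> M.nball n K. y n = c \<otimes>\<^bsub>G n\<^esub> s n \<otimes>\<^bsub>G n\<^esub> inv\<^bsub>G n\<^esub> c" for s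
  proof -
    \<comment> \<open>The dummy d gives the statement the form that \<open>eventually_choice\<close>
      expects, which selects pairs.\<close>
    have "\<forall>\<^sub>F n in \<U>. \<exists>c \<in> carrier (G n). \<exists>d \<in> carrier (G n).
        nrm n c \<le> of_nat K \<and> y n = c \<otimes>\<^bsub>G n\<^esub> s n \<otimes>\<^bsub>G n\<^esub> inv\<^bsub>G n\<^esub> c"
      using ev by eventually_elim (use M.one_closed in \<open>auto simp: M.nball_def\<close>)
    then obtain c where c: "\<And>n. c n \<in> carrier (G n)"
      "\<forall>\<^sub>F n in \<U>. nrm n (c n) \<le> of_nat K \<and> y n = c n \<otimes>\<^bsub>G n\<^esub> s n \<otimes>\<^bsub>G n\<^esub> inv\<^bsub>G n\<^esub> c n"
      by (rule eventually_choice) blast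
    have evc: "\<forall>\<^sub>F n in \<U>. nrm n (c n) \<le> of_nat K"
      "\<forall>\<^sub>F n in \<U>. y n = c n \<otimes>\<^bsub>G n\<^esub> s n \<otimes>\<^bsub>G n\<^esub> inv\<^bsub>G n\<^esub> c n"
      using c(2) by (auto elim: eventually_mono)
    have fin: "fin_seq c" using c(1) evc(1) unfolding fin_seq_def by blast
    let ?z = "\<lambda>n. c n \<otimes>\<^bsub>G n\<^esub> s n \<otimes>\<^bsub>G n\<^esub> inv\<^bsub>G n\<^esub> c n"
    have z: "fin_seq ?z" using fin s(1) by (intro fin_seq_mult fin_seq_inv)
    have "cls y = cls ?z" using evc(2) by (rule cls_cong[OF y(1) fin_seq_carrier[OF z]])
    also have "\<dots> = cls c \<otimes>\<^bsub>Fin\<^esub> cls s \<otimes>\<^bsub>Fin\<^esub> inv\<^bsub>Fin\<^esub> cls c"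
      using cls_conj[OF fin s(1)] by simp
    finally have "cls y \<in> conj_gens Fin (carrier Fin) (cls g)"
      using cls_closed[OF fin] s(2) unfolding conj_gens_def by blast
    then show ?thesis using fin_seq_cong[OF z y(1) evc(2)] by blast
  qed
  have "\<forall>\<^sub>F n in \<U>. y n = \<one>\<^bsub>G n\<^esub> \<or>
      (\<exists>c \<in> M.nball n K. y n = c \<otimes>\<^bsub>G n\<^esub> g n \<otimes>\<^bsub>G n\<^esub> inv\<^bsub>G n\<^esub> c) \<or>
      (\<exists>c \<in> M.nball n K. y n = c \<otimes>\<^bsub>G n\<^esub> inv\<^bsub>G n\<^esub> g n \<otimes>\<^bsub>G n\<^esub> inv\<^bsub>G n\<^esub> c)"
    using y(2) by eventually_elim (auto simp: conj_gens_def)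
  then show ?thesis
  proof (cases rule: eventually_cases)
    case 1
    have "cls y = \<one>\<^bsub>Fin\<^esub>" unfolding one_Fin using 1 by (intro cls_cong y) auto
    moreover have "fin_seq y" using fin_seq_cong[OF fin_seq_one y(1) 1] .
    ultimately show ?thesis by (simp add: conj_gens_def)
  next
    case 2
    then show ?thesis
    proof (cases rule: eventually_cases)
      case 1
      then show ?thesis by (rule conj[OF g, rotated]) simp
    next
      case 2
      then show ?thesis by (rule conj[OF fin_seq_inv[OF g], rotated]) (simp add: cls_inv[OF g])
    qed
  qed
qed

lemma conj_words_proj:
  assumes g: "fin_seq g" and "\<And>n. w n \<in> carrier (G n)"
    "\<forall>\<^sub>F n in \<U>. w n \<in> conj_words (G n) (M.nball n K) (g n) L"
  shows "fin_seq w \<and> cls w \<in> conj_words Fin (carrier Fin) (cls g) L"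
  using assms(2,3)
proof (induction L arbitrary: w)
  case 0
  then have ev: "\<forall>\<^sub>F n in \<U>. w n = \<one>\<^bsub>G n\<^esub>" by simp
  have "cls w = \<one>\<^bsub>Fin\<^esub>" unfolding one_Fin using ev 0 by (intro cls_cong) auto
  then show ?case using fin_seq_cong[OF fin_seq_one 0(1) ev] by simp
next
  case (Suc L)
  let ?P = "\<lambda>n y u. y \<in> conj_gens (G n) (M.nball n K) (g n) \<and>
    u \<in> conj_words (G n) (M.nball n K) (g n) L \<and> w n = y \<otimes>\<^bsub>G n\<^esub> u"
  have "\<forall>\<^sub>F n in \<U>. \<exists>y \<in> carrier (G n). \<exists>u \<in> carrier (G n). ?P n y u"
    using Suc.prems(2)
  proof eventually_elim
    case (elim n)
    then obtain y u where "?P n y u" by auto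
    then show ?case
      using M.conj_gens_closed[OF M.nball_closed fin_seq_carrier[OF g, of n]]
        M.conj_words_closed[OF M.nball_closed fin_seq_carrier[OF g, of n]] by blast
  qed
  then obtain y u where yu: "\<And>n. y n \<in> carrier (G n)" "\<And>n. u n \<in> carrier (G n)"
    and ev: "\<forall>\<^sub>F n in \<U>. ?P n (y n) (u n)"
    by (rule eventually_choice) blast
  have y: "fin_seq y" "cls y \<in> conj_gens Fin (carrier Fin) (cls g)"
    using conj_gens_proj[OF g yu(1) eventually_mono[OF ev]] by blast+
  have u: "fin_seq u" "cls u \<in> conj_words Fin (carrier Fin) (cls g) L"
    using Suc.IH[OF yu(2) eventually_mono[OF ev]] by blast+
  have ev': "\<forall>\<^sub>F n in \<U>. w n = y n \<otimes>\<^bsub>G n\<^esub> u n" using ev by eventually_elim simp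
  have "cls w = cls y \<otimes>\<^bsub>Fin\<^esub> cls u"
    unfolding cls_mult[OF yu] using ev' Suc.prems(1) yu by (intro cls_cong) auto
  moreover have "fin_seq w" using fin_seq_cong[OF fin_seq_mult[OF y(1) u(1)] Suc.prems(1) ev'] .
  ultimately show ?case using y(2) u(2) by auto
qed

text \<open>From right to left, saturation merges the approximating words for all \<epsilon> into
  one sequence of words of length L at infinitesimal distance from x, hence in the same class. This
  needs L and K to be chosen before \<epsilon>.\<close>

lemma cls_in_conj_words_iff:
  assumes g: "fin_seq g" and x: "fin_seq x"
  shows "cls x \<in> conj_words Fin (carrier Fin) (cls g) L \<longleftrightarrow>
    (\<exists>K. \<forall>\<epsilon>>0. \<forall>\<^sub>F n in \<U>. M.near n L K \<epsilon> (g n) (x n))"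
proof
  assume "cls x \<in> conj_words Fin (carrier Fin) (cls g) L"
  then obtain w K where w: "fin_seq w" "cls w = cls x"
    and ev: "\<forall>\<^sub>F n in \<U>. w n \<in> conj_words (G n) (M.nball n K) (g n) L"
    using conj_words_lift[OF g] by blast
  have "\<forall>\<^sub>F n in \<U>. M.near n L K \<epsilon> (g n) (x n)" if "\<epsilon> > 0" for \<epsilon>
  proof -
    have "\<forall>\<^sub>F n in \<U>. M.gdist n (x n) (w n) < \<epsilon>"
      using cls_eq_iff[of x w] w x that by (auto simp: fin_seq_carrier)
    then show ?thesis using ev by eventually_elim (auto simp: M.near_def)
  qed
  then show "\<exists>K. \<forall>\<epsilon>>0. \<forall>\<^sub>F n in \<U>. M.near n L K \<epsilon> (g n) (x n)" by blast
next
  assume "\<exists>K. \<forall>\<epsilon>>0. \<forall>\<^sub>F n in \<U>. M.near n L K \<epsilon> (g n) (x n)"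
  then obtain K where K: "\<And>\<epsilon>. \<epsilon> > 0 \<Longrightarrow> \<forall>\<^sub>F n in \<U>. M.near n L K \<epsilon> (g n) (x n)" by blast
  \<comment> \<open>Saturation handles countably many conditions, so the tolerances run through a
    null sequence.\<close>
  define e where "e k = ennreal (inverse (real (Suc k)))" for k
  have e: "e k > 0" "j \<le> k \<Longrightarrow> e k \<le> e j" for j k
    by (auto simp: e_def intro!: ennreal_leI le_imp_inverse_le)
  define B where "B k n = {w \<in> conj_words (G n) (M.nball n K) (g n) L. M.gdist n (x n) w < e k}" for k n
  have "\<forall>\<^sub>F n in \<U>. carrier (G n) \<inter> (\<Inter>j\<le>k. B j n) \<noteq> {}" for k
    using K[OF e(1)[of k]]
  proof eventually_elim
    case (elim n)
    then obtain w where w: "w \<in> conj_words (G n) (M.nball n K) (g n) L" "M.gdist n (x n) w < e k"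
      by (auto simp: M.near_def)
    then have "w \<in> carrier (G n) \<inter> (\<Inter>j\<le>k. B j n)"
      using M.conj_words_closed[OF M.nball_closed fin_seq_carrier[OF g, of n]] e(2)
      by (auto simp: B_def intro: order_less_le_trans)
    then show ?case by blast
  qed
  moreover have "carrier (G n) \<noteq> {}" for n using M.one_closed by blast
  ultimately obtain w where w: "\<And>n. w n \<in> carrier (G n)" "\<And>k. \<forall>\<^sub>F n in \<U>. w n \<in> B k n"
    using ultrafilter_saturation[OF nonprincipal, of "\<lambda>n. carrier (G n)" B] by blast
  have "\<forall>\<^sub>F n in \<U>. M.gdist n (x n) (w n) < \<epsilon>" if "\<epsilon> > 0" for \<epsilon>
  proof -
    obtain k where "e k \<le> \<epsilon>"
    proof (cases \<epsilon>)
      case (real r)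
      then have "r > 0" using \<open>\<epsilon> > 0\<close> by simp
      then obtain k where "inverse (real (Suc k)) < r" using reals_Archimedean by blast
      then have "e k \<le> \<epsilon>" unfolding real e_def by (intro ennreal_leI) simp
      then show ?thesis using that by blast
    qed (use that in auto)
    then show ?thesis
      using w(2)[of k] by (auto simp: B_def elim!: eventually_mono)
  qed
  then have "cls x = cls w"
    using cls_eq_iff[of x w] x w(1) by (simp add: fin_seq_carrier)
  moreover have "\<forall>\<^sub>F n in \<U>. w n \<in> conj_words (G n) (M.nball n K) (g n) L"
    using w(2)[of 0] by eventually_elim (simp add: B_def)
  ultimately show "cls x \<in> conj_words Fin (carrier Fin) (cls g) L"
    using conj_words_proj[OF g w(1)] by simp
qed

end

section \<open>Transfer along almost isometric copies of pairs\<close>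

lemma near_hom:
  assumes G: "metric_group G nrmG" and H: "metric_group H nrmH"
    and \<phi>: "\<phi> \<in> hom G H" and isom: "\<And>g. g \<in> carrier G \<Longrightarrow> nrmH (\<phi> g) = nrmG g"
    and c: "g \<in> carrier G" "x \<in> carrier G" and near: "metric_group.near G nrmG L K \<epsilon> g x"
  shows "metric_group.near H nrmH L K \<epsilon> (\<phi> g) (\<phi> x)"
proof -
  interpret G: metric_group G nrmG by (rule G)
  interpret H: metric_group H nrmH by (rule H)
  interpret group_hom G H \<phi>
    using \<phi> by (simp add: group_hom_def group_hom_axioms_def G.is_group H.is_group)
  obtain w where w: "w \<in> conj_words G (G.nball K) g L" "G.gdist x w < \<epsilon>"
    using near by (auto simp: G.near_def)
  have wc: "w \<in> carrier G" using w(1) G.conj_words_closed[OF G.nball_closed c(1)] by blast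
  have "\<phi> w \<in> conj_words H (H.nball K) (\<phi> g) L"
    by (rule conj_words_hom[OF G.is_group H.is_group \<phi> G.nball_closed c(1) _ w(1)])
      (auto simp: G.nball_def H.nball_def isom)
  moreover have "H.gdist (\<phi> x) (\<phi> w) = G.gdist x w"
    using isom[of "x \<otimes>\<^bsub>G\<^esub> inv\<^bsub>G\<^esub> w"] c wc by (simp add: G.gdist_def H.gdist_def)
  ultimately show ?thesis using w(2) unfolding H.near_def by metis
qed

text \<open>\<open>B\<close> is the constant family, so that the results on finitary ultraproducts
  apply to H as well: words are found in \<open>A\<close> and read off in \<open>B\<close>.\<close>

locale approximable_pairs =
  A: metric_groups \<U> G nrm' + H: metric_group H nrm + B: metric_groups \<U> "\<lambda>_. H" "\<lambda>_. nrm"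
  for \<U> and G :: "nat \<Rightarrow> ('a, 'm) monoid_scheme" and nrm' and H :: "('b, 'k) monoid_scheme" and nrm +
  assumes approx: "\<lbrakk>(t::real) > 0; (\<epsilon>::real) > 0; h\<^sub>1 \<in> carrier H; h\<^sub>2 \<in> carrier H;
            nrm h\<^sub>1 \<le> ennreal t; nrm h\<^sub>2 \<le> ennreal t\<rbrakk> \<Longrightarrow>
          \<forall>\<^sub>F n in \<U>. \<exists>g\<^sub>1 \<in> carrier (G n). \<exists>g\<^sub>2 \<in> carrier (G n). \<exists>\<phi> \<in> hom (G n) H.
            (\<forall>g \<in> carrier (G n). nrm (\<phi> g) = nrm' n g) \<and>
            nrm (\<phi> g\<^sub>1 \<otimes>\<^bsub>H\<^esub> inv\<^bsub>H\<^esub> h\<^sub>1) < ennreal \<epsilon> \<and>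
            nrm (\<phi> g\<^sub>2 \<otimes>\<^bsub>H\<^esub> inv\<^bsub>H\<^esub> h\<^sub>2) < ennreal \<epsilon>"
begin

lemma approx_gdist:
  assumes r: "r > 0" and h: "h\<^sub>1 \<in> carrier H" "h\<^sub>2 \<in> carrier H" "nrm h\<^sub>1 \<le> of_nat t" "nrm h\<^sub>2 \<le> of_nat T"
  shows "\<forall>\<^sub>F n in \<U>. \<exists>g\<^sub>1 \<in> carrier (G n). \<exists>g\<^sub>2 \<in> carrier (G n). \<exists>\<phi> \<in> hom (G n) H.
    (\<forall>g \<in> carrier (G n). nrm (\<phi> g) = nrm' n g) \<and> H.gdist (\<phi> g\<^sub>1) h\<^sub>1 < r \<and> H.gdist (\<phi> g\<^sub>2) h\<^sub>2 < r"
proof -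
  obtain s where s: "0 < s" "s \<le> r" "s < \<infinity>" using ennreal_small_multiple[OF r, of 1] by auto
  then obtain \<epsilon> where \<epsilon>: "s = ennreal \<epsilon>" "\<epsilon> > 0" by (cases s) auto
  \<comment> \<open>The hypothesis wants a single real bound t > 0 for both norms, hence the sum and
    the successor.\<close>
  have T: "of_nat t \<le> ennreal (real (Suc (t + T)))" "of_nat T \<le> ennreal (real (Suc (t + T)))"
    unfolding ennreal_of_nat_eq_real_of_nat by (intro ennreal_leI; simp)+
  have "\<forall>\<^sub>F n in \<U>. \<exists>g\<^sub>1 \<in> carrier (G n). \<exists>g\<^sub>2 \<in> carrier (G n). \<exists>\<phi> \<in> hom (G n) H.
    (\<forall>g \<in> carrier (G n). nrm (\<phi> g) = nrm' n g) \<and>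
    nrm (\<phi> g\<^sub>1 \<otimes>\<^bsub>H\<^esub> inv\<^bsub>H\<^esub> h\<^sub>1) < ennreal \<epsilon> \<and> nrm (\<phi> g\<^sub>2 \<otimes>\<^bsub>H\<^esub> inv\<^bsub>H\<^esub> h\<^sub>2) < ennreal \<epsilon>"
    by (rule approx[of "real (Suc (t + T))"]) (use h \<epsilon> T in \<open>auto intro: order_trans\<close>)
  then show ?thesis
  proof eventually_elim
    case (elim n)
    then show ?case using s \<epsilon> unfolding H.gdist_def by (meson order_less_le_trans)
  qed
qed

text \<open>An error below \<sigma> turns the lower bound \<sigma> + \<sigma> for
  \<open>h\<^sub>1\<close> into \<sigma> for its preimage, and an error below 1 raises the upper
  bounds by 1.\<close>

lemma approx_shell:
  assumes r: "r > 0" "r \<le> \<sigma>" "r \<le> 1" "\<sigma> < \<infinity>" and h: "h\<^sub>1 \<in> carrier H" "h\<^sub>2 \<in> carrier H"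
    and bounds: "\<sigma> + \<sigma> \<le> nrm h\<^sub>1" "nrm h\<^sub>1 \<le> of_nat t" "nrm h\<^sub>2 \<le> of_nat T"
  shows "\<forall>\<^sub>F n in \<U>. \<exists>g\<^sub>1 \<in> A.shell \<sigma> (t + 1) n. \<exists>g\<^sub>2 \<in> carrier (G n). \<exists>\<phi> \<in> hom (G n) H.
    (\<forall>g \<in> carrier (G n). nrm (\<phi> g) = nrm' n g) \<and> nrm' n g\<^sub>2 \<le> of_nat (T + 1) \<and>
    H.gdist (\<phi> g\<^sub>1) h\<^sub>1 < r \<and> H.gdist (\<phi> g\<^sub>2) h\<^sub>2 < r"
  using approx_gdist[OF r(1) h bounds(2,3)]
proof eventually_elim
  case (elim n)
  then obtain g\<^sub>1 g\<^sub>2 \<phi> where g: "g\<^sub>1 \<in> carrier (G n)" "g\<^sub>2 \<in> carrier (G n)" and \<phi>: "\<phi> \<in> hom (G n) H"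
    and isom: "\<forall>g \<in> carrier (G n). nrm (\<phi> g) = nrm' n g"
    and d: "H.gdist (\<phi> g\<^sub>1) h\<^sub>1 < r" "H.gdist (\<phi> g\<^sub>2) h\<^sub>2 < r"
    by blast
  have c: "\<phi> g\<^sub>1 \<in> carrier H" "\<phi> g\<^sub>2 \<in> carrier H" using g \<phi> by (auto simp: hom_def)
  have upper: "nrm' n g \<le> of_nat (k + 1)"
    if "g \<in> carrier (G n)" "\<phi> g \<in> carrier H" "h \<in> carrier H" "H.gdist (\<phi> g) h < r" "nrm h \<le> of_nat k" for g h k
  proof -
    have "nrm' n g = nrm (\<phi> g)" using isom that by simp
    also have "\<dots> \<le> nrm h + H.gdist (\<phi> g) h" using that by (intro H.nrm_le_gdist)
    also have "\<dots> \<le> of_nat k + 1" using that r(3) by (intro add_mono) auto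
    finally show ?thesis by (simp add: add.commute)
  qed
  have "\<sigma> + \<sigma> \<le> nrm (\<phi> g\<^sub>1) + H.gdist h\<^sub>1 (\<phi> g\<^sub>1)"
    using bounds(1) H.nrm_le_gdist[OF h(1) c(1)] by (rule order_trans)
  also have "\<dots> \<le> nrm (\<phi> g\<^sub>1) + \<sigma>"
    using d(1) r(2) H.gdist_commute[OF h(1) c(1)] by (intro add_mono) auto
  finally have "\<sigma> + \<sigma> \<le> \<sigma> + nrm (\<phi> g\<^sub>1)" by (simp only: add.commute)
  then have "\<sigma> \<le> nrm' n g\<^sub>1" using r(4) isom g by (auto simp: ennreal_add_left_cancel_le)
  then have "g\<^sub>1 \<in> A.shell \<sigma> (t + 1) n"
    using upper[OF g(1) c(1) h(1) d(1) bounds(2)] g by (simp add: A.shell_def)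
  then show ?case using g \<phi> isom d upper[OF g(2) c(2) h(2) d(2) bounds(3)] by blast
qed

text \<open>For \<U>-many n both elements have near preimages in \<open>G n\<close>. The word found
  there is carried to H by the isometric embedding, and \<open>near_perturb\<close> moves it back to
  \<open>h\<^sub>1\<close> and \<open>h\<^sub>2\<close>. The conclusion does not mention n, so a
  single good n settles it.\<close>

lemma near_transfer:
  assumes near: "\<And>\<epsilon>. \<epsilon> > 0 \<Longrightarrow> \<forall>\<^sub>F n in \<U>. \<forall>h \<in> A.shell \<sigma> (t + 1) n. \<forall>x \<in> carrier (G n).
      nrm' n x \<le> of_nat (T + 1) \<longrightarrow> A.M.near n L K \<epsilon> h x"
    and \<sigma>: "\<sigma> > 0" "\<sigma> < \<infinity>" and h: "h\<^sub>1 \<in> carrier H" "h\<^sub>2 \<in> carrier H"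
    and bounds: "\<sigma> + \<sigma> \<le> nrm h\<^sub>1" "nrm h\<^sub>1 \<le> of_nat t" "nrm h\<^sub>2 \<le> of_nat T" and \<epsilon>: "\<epsilon> > 0"
  shows "H.near L K \<epsilon> h\<^sub>1 h\<^sub>2"
proof -
  obtain s where s: "s > 0" "of_nat (L + 2) * s \<le> \<epsilon>"
    using ennreal_small_multiple[OF \<epsilon>] by blast
  \<comment> \<open>The bound s pays for the perturbation; \<sigma> and 1 are the bounds required by
    \<open>approx_shell\<close>.\<close>
  define r where "r = min s (min \<sigma> 1)"
  have "of_nat (L + 2) * r \<le> of_nat (L + 2) * s"
    by (intro mult_left_mono) (auto simp: r_def)
  then have rL: "of_nat (L + 2) * r \<le> \<epsilon>" using s(2) by (rule order_trans)
  have r: "r > 0" "r \<le> \<sigma>" "r \<le> 1" "r < \<infinity>"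
    using s(1) \<sigma> by (auto simp: r_def min_less_iff_disj min.coboundedI2)
  have "\<forall>\<^sub>F n in \<U>. H.near L K \<epsilon> h\<^sub>1 h\<^sub>2"
    using near[OF r(1)] approx_shell[OF r(1-3) \<sigma>(2) h bounds]
  proof eventually_elim
    case (elim n)
    then obtain g\<^sub>1 g\<^sub>2 \<phi> where g: "g\<^sub>1 \<in> A.shell \<sigma> (t + 1) n" "g\<^sub>2 \<in> carrier (G n)" "nrm' n g\<^sub>2 \<le> of_nat (T + 1)"
      and \<phi>: "\<phi> \<in> hom (G n) H" and isom: "\<forall>g \<in> carrier (G n). nrm (\<phi> g) = nrm' n g"
      and d: "H.gdist (\<phi> g\<^sub>1) h\<^sub>1 < r" "H.gdist (\<phi> g\<^sub>2) h\<^sub>2 < r"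
      by blast
    have gc: "g\<^sub>1 \<in> carrier (G n)" using g(1) by (simp add: A.shell_def)
    have c: "\<phi> g\<^sub>1 \<in> carrier H" "\<phi> g\<^sub>2 \<in> carrier H" using g gc \<phi> by (auto simp: hom_def)
    have "A.M.near n L K r g\<^sub>1 g\<^sub>2" using elim(1) g by blast
    then have "H.near L K r (\<phi> g\<^sub>1) (\<phi> g\<^sub>2)"
      using isom by (intro near_hom[OF A.metric_group B.metric_group \<phi> _ gc g(2)]) auto
    then show ?case
    proof (rule H.near_perturb[OF _ c(1) h(1) c(2) h(2)])
      show "H.gdist (\<phi> g\<^sub>1) h\<^sub>1 \<le> r" using d(1) by simp
      show "H.gdist h\<^sub>2 (\<phi> g\<^sub>2) \<le> r" using d(2) H.gdist_commute[OF h(2) c(2)] by simp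
    qed (use rL r in auto)
  qed
  then show ?thesis using A.not_bot by (simp add: eventually_const)
qed

section \<open>Nontrivial sequences on both sides\<close>

lemma nontriv_seq_bounds:
  assumes "B.fin_seq h" "B.nontriv_seq h"
  obtains \<sigma> T where "\<sigma> > 0" "\<sigma> < \<infinity>" "\<forall>\<^sub>F n in \<U>. \<sigma> + \<sigma> \<le> nrm (h n) \<and> nrm (h n) \<le> of_nat T"
proof -
  obtain \<delta> where \<delta>: "\<delta> > 0" "\<forall>\<^sub>F n in \<U>. \<delta> \<le> nrm (h n)" using assms(2) by (auto simp: B.nontriv_seq_def)
  obtain T :: nat where T: "\<forall>\<^sub>F n in \<U>. nrm (h n) \<le> of_nat T" using assms(1) by (auto simp: B.fin_seq_def)
  obtain \<sigma> where \<sigma>: "\<sigma> > 0" "\<sigma> < \<infinity>" "of_nat 2 * \<sigma> \<le> \<delta>" using ennreal_small_multiple[OF \<delta>(1)] by blast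
  have "\<forall>\<^sub>F n in \<U>. \<sigma> + \<sigma> \<le> nrm (h n) \<and> nrm (h n) \<le> of_nat T"
    using \<delta>(2) T by eventually_elim (use \<sigma>(3) in \<open>auto simp: mult_2\<close>)
  then show ?thesis using that \<sigma> by blast
qed

text \<open>Bounded simplicity admits the trivial group, so the nontrivial g on which
  \<open>near_bootstrap\<close> rests has to be produced from h. One entry \<open>h m\<close> away
  from the identity, copied into \<U>-many \<open>G n\<close>, is enough.\<close>

lemma nontriv_seq_back:
  assumes h: "B.fin_seq h" "B.nontriv_seq h"
  shows "\<exists>g. A.fin_seq g \<and> A.nontriv_seq g"
proof -
  obtain \<sigma> T where \<sigma>: "\<sigma> > 0" "\<sigma> < \<infinity>" and ev: "\<forall>\<^sub>F n in \<U>. \<sigma> + \<sigma> \<le> nrm (h n) \<and> nrm (h n) \<le> of_nat T"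
    by (rule nontriv_seq_bounds[OF h])
  obtain m where m: "\<sigma> + \<sigma> \<le> nrm (h m)" "nrm (h m) \<le> of_nat T"
    using eventually_happens'[OF A.not_bot ev] by blast
  have r: "min \<sigma> 1 > 0" "min \<sigma> 1 \<le> \<sigma>" "min \<sigma> 1 \<le> 1" using \<sigma> by auto
  have hc: "h m \<in> carrier H" using B.fin_seq_carrier[OF h(1)] .
  have "\<forall>\<^sub>F n in \<U>. \<exists>g \<in> carrier (G n). \<exists>x \<in> carrier (G n). g \<in> A.shell \<sigma> (T + 1) n"
    using approx_shell[OF r \<sigma>(2) hc hc m m(2)]
    by eventually_elim (auto simp: A.shell_def)
  then obtain g where "\<And>n. g n \<in> carrier (G n)" "\<forall>\<^sub>F n in \<U>. g n \<in> A.shell \<sigma> (T + 1) n"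
    by (rule A.eventually_choice) blast
  then show ?thesis using A.shell_seq[OF _ _ \<sigma>(1)] by blast
qed

lemma nontriv_seq_forth:
  assumes g: "A.fin_seq g" "A.nontriv_seq g"
  shows "\<exists>h. B.fin_seq h \<and> B.nontriv_seq h"
proof -
  obtain \<delta> where \<delta>: "\<delta> > 0" "\<forall>\<^sub>F n in \<U>. \<delta> \<le> nrm' n (g n)" using g(2) by (auto simp: A.nontriv_seq_def)
  obtain T :: nat where T: "\<forall>\<^sub>F n in \<U>. nrm' n (g n) \<le> of_nat T" using g(1) by (auto simp: A.fin_seq_def)
  have "\<forall>\<^sub>F n in \<U>. \<exists>\<phi> \<in> hom (G n) H. \<forall>g \<in> carrier (G n). nrm (\<phi> g) = nrm' n g"
    \<comment> \<open>Only the existence of the embedding matters here, so the identity is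
      approximated twice.\<close>
    using approx_gdist[of 1 "\<one>\<^bsub>H\<^esub>" "\<one>\<^bsub>H\<^esub>" 0] by (auto elim!: eventually_mono)
  then have "\<forall>\<^sub>F n in \<U>. \<exists>h \<in> carrier H. \<exists>x \<in> carrier H. \<delta> \<le> nrm h \<and> nrm h \<le> of_nat T"
    using \<delta>(2) T
  proof eventually_elim
    case (elim n)
    then obtain \<phi> where "\<phi> \<in> hom (G n) H" "nrm (\<phi> (g n)) = nrm' n (g n)"
      using A.fin_seq_carrier[OF g(1)] by blast
    then show ?case using elim A.fin_seq_carrier[OF g(1), of n] by (auto simp: hom_def intro!: bexI[of _ "\<phi> (g n)"])
  qed
  then obtain h where h: "\<And>n. h n \<in> carrier H" "\<forall>\<^sub>F n in \<U>. \<delta> \<le> nrm (h n) \<and> nrm (h n) \<le> of_nat T"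
    by (rule B.eventually_choice) blast
  then have "\<forall>\<^sub>F n in \<U>. h n \<in> B.shell \<delta> T n" by (simp add: B.shell_def)
  then show ?thesis using B.shell_seq[of h, OF h(1) _ \<delta>(1)] by blast
qed

text \<open>Provides the hypothesis \<open>words\<close> of the lemmas on shells, with length and
  conjugator bound merged into one number.\<close>

lemma Fin_words_uniform:
  assumes words: "\<forall>g \<in> carrier A.Fin - {\<one>\<^bsub>A.Fin\<^esub>}. \<forall>x \<in> carrier A.Fin.
      \<exists>L. x \<in> conj_words A.Fin (carrier A.Fin) g L"
    and g: "A.fin_seq g" "A.nontriv_seq g" and x: "A.fin_seq x"
  shows "\<exists>K. \<forall>\<epsilon>>0. \<forall>\<^sub>F n in \<U>. A.M.near n K K \<epsilon> (g n) (x n)"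
proof -
  have "A.cls g \<in> carrier A.Fin - {\<one>\<^bsub>A.Fin\<^esub>}"
    using A.cls_closed[OF g(1)] A.cls_nontrivial_iff[OF g(1)] g(2) by simp
  then obtain L where "A.cls x \<in> conj_words A.Fin (carrier A.Fin) (A.cls g) L"
    using words A.cls_closed[OF x] by metis
  then obtain K where K: "\<And>\<epsilon>. \<epsilon> > 0 \<Longrightarrow> \<forall>\<^sub>F n in \<U>. A.M.near n L K \<epsilon> (g n) (x n)"
    using A.cls_in_conj_words_iff[OF g(1) x] by blast
  have "\<forall>\<^sub>F n in \<U>. A.M.near n (max L K) (max L K) \<epsilon> (g n) (x n)" if "\<epsilon> > 0" for \<epsilon>
    using K[OF that] by eventually_elim (erule A.M.near_mono[OF _ A.fin_seq_carrier[OF g(1)]], auto)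
  then show ?thesis by blast
qed

text \<open>\<open>near_transfer\<close> is applied to each pair (h n, x n) separately, each time
  with its own quantification over the family; L and K are the same throughout, as the class
  requires.\<close>

lemma cls_in_conj_wordsI:
  assumes near: "\<And>\<epsilon>. \<epsilon> > 0 \<Longrightarrow> \<forall>\<^sub>F n in \<U>. \<forall>h \<in> A.shell \<sigma> (t + 1) n. \<forall>x \<in> carrier (G n).
      nrm' n x \<le> of_nat (T + 1) \<longrightarrow> A.M.near n L K \<epsilon> h x"
    and \<sigma>: "\<sigma> > 0" "\<sigma> < \<infinity>" and h: "B.fin_seq h" and x: "B.fin_seq x"
    and bounds: "\<forall>\<^sub>F n in \<U>. \<sigma> + \<sigma> \<le> nrm (h n) \<and> nrm (h n) \<le> of_nat t"
      "\<forall>\<^sub>F n in \<U>. nrm (x n) \<le> of_nat T"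
  shows "B.cls x \<in> conj_words B.Fin (carrier B.Fin) (B.cls h) L"
proof -
  have "\<forall>\<^sub>F n in \<U>. H.near L K \<epsilon> (h n) (x n)" if "\<epsilon> > 0" for \<epsilon>
    using bounds
  proof eventually_elim
    case (elim n)
    show ?case
    proof (rule near_transfer[where \<sigma> = \<sigma> and t = t and T = T])
      show "\<forall>\<^sub>F n in \<U>. \<forall>h \<in> A.shell \<sigma> (t + 1) n. \<forall>x \<in> carrier (G n).
        nrm' n x \<le> of_nat (T + 1) \<longrightarrow> A.M.near n L K \<eta> h x" if "\<eta> > 0" for \<eta>
        by (rule near[OF that])
    qed (use elim \<sigma> that B.fin_seq_carrier[OF h] B.fin_seq_carrier[OF x] in auto)
  qed
  then show ?thesis using B.cls_in_conj_words_iff[OF h x] by blast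
qed

section \<open>Transfer of simplicity and of bounded simplicity\<close>

lemma simple_transfer:
  assumes "is_simple_grp A.Fin"
  shows "is_simple_grp B.Fin"
proof -
  note simple = assms[unfolded is_simple_grp_iff_conj_words]
  note words = Fin_words_uniform[OF conjunct2[OF conjunct2[OF simple]]]
  obtain X where "X \<in> carrier A.Fin" "X \<noteq> \<one>\<^bsub>A.Fin\<^esub>"
    using conjunct1[OF conjunct2[OF simple]] monoid.one_closed[OF group.is_monoid[OF A.group_Fin]]
    by auto
  then obtain g where g: "A.fin_seq g" "A.nontriv_seq g"
    using A.cls_nontrivial_iff by (auto simp: A.carrier_Fin)
  have "carrier B.Fin \<noteq> {\<one>\<^bsub>B.Fin\<^esub>}"
    using nontriv_seq_forth[OF g] B.cls_closed B.cls_nontrivial_iff by blast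
  moreover have "\<exists>L. X \<in> conj_words B.Fin (carrier B.Fin) Y L"
    if Y: "Y \<in> carrier B.Fin - {\<one>\<^bsub>B.Fin\<^esub>}" and X: "X \<in> carrier B.Fin" for X Y
  proof -
    obtain h where h: "B.fin_seq h" "B.nontriv_seq h" "Y = B.cls h"
      using Y B.cls_nontrivial_iff by (auto simp: B.carrier_Fin)
    obtain x where x: "B.fin_seq x" "X = B.cls x" using X by (auto simp: B.carrier_Fin)
    obtain \<sigma> t where \<sigma>: "\<sigma> > 0" "\<sigma> < \<infinity>" and ht: "\<forall>\<^sub>F n in \<U>. \<sigma> + \<sigma> \<le> nrm (h n) \<and> nrm (h n) \<le> of_nat t"
      by (rule nontriv_seq_bounds[OF h(1,2)])
    obtain s :: nat where s: "\<forall>\<^sub>F n in \<U>. nrm (x n) \<le> of_nat s" using x(1) by (auto simp: B.fin_seq_def)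
    obtain L \<rho> where "\<rho> > 0" and boot:
      "\<And>N S K. \<forall>\<^sub>F n in \<U>. \<forall>h \<in> A.shell \<sigma> (t + 1) n. \<forall>x \<in> carrier (G n).
          nrm' n x \<le> of_nat S \<longrightarrow> A.M.near n N K \<rho> h x \<Longrightarrow>
        \<exists>K. \<forall>\<epsilon>>0. \<forall>\<^sub>F n in \<U>. \<forall>h \<in> A.shell \<sigma> (t + 1) n. \<forall>x \<in> carrier (G n).
          nrm' n x \<le> of_nat S \<longrightarrow> A.M.near n (L + N) K \<epsilon> h x"
      by (rule A.near_bootstrap[OF words g \<sigma>(1)]) blast+
    \<comment> \<open>N depends on the norm bound s of x. Simplicity allows this, since the length
      may vary with X.\<close>
    obtain N where "\<forall>\<^sub>F n in \<U>. \<forall>h \<in> A.shell \<sigma> (t + 1) n. \<forall>x \<in> carrier (G n).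
        nrm' n x \<le> of_nat (s + 1) \<longrightarrow> A.M.near n N N \<rho> h x"
      using A.near_shell[OF words \<sigma>(1) \<open>\<rho> > 0\<close>] by blast
    then obtain K where K: "\<forall>\<epsilon>>0. \<forall>\<^sub>F n in \<U>. \<forall>h \<in> A.shell \<sigma> (t + 1) n. \<forall>x \<in> carrier (G n).
        nrm' n x \<le> of_nat (s + 1) \<longrightarrow> A.M.near n (L + N) K \<epsilon> h x"
      using boot by blast
    have "X \<in> conj_words B.Fin (carrier B.Fin) Y (L + N)"
      unfolding x(2) h(3)
      by (rule cls_in_conj_wordsI[OF K[rule_format] \<sigma> h(1) x(1) ht s])
    then show ?thesis by blast
  qed
  ultimately show ?thesis
    unfolding is_simple_grp_iff_conj_words using B.group_Fin by blast
qed

lemma boundedly_simple_transfer: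
  assumes "boundedly_simple A.Fin"
  shows "boundedly_simple B.Fin"
proof -
  note bounded = conjunct2[OF assms[unfolded boundedly_simple_iff_conj_words]]
  have "\<forall>g \<in> carrier A.Fin - {\<one>\<^bsub>A.Fin\<^esub>}. \<forall>x \<in> carrier A.Fin.
      \<exists>L. x \<in> conj_words A.Fin (carrier A.Fin) g L"
    using bounded by meson
  note words = Fin_words_uniform[OF this]
  have "\<exists>L. \<forall>X \<in> carrier B.Fin. X \<in> conj_words B.Fin (carrier B.Fin) Y L"
    if Y: "Y \<in> carrier B.Fin - {\<one>\<^bsub>B.Fin\<^esub>}" for Y
  proof -
    obtain h where h: "B.fin_seq h" "B.nontriv_seq h" "Y = B.cls h"
      using Y B.cls_nontrivial_iff by (auto simp: B.carrier_Fin)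
    obtain g where g: "A.fin_seq g" "A.nontriv_seq g" using nontriv_seq_back[OF h(1,2)] by blast
    have "A.cls g \<in> carrier A.Fin - {\<one>\<^bsub>A.Fin\<^esub>}"
      using A.cls_closed[OF g(1)] A.cls_nontrivial_iff[OF g(1)] g(2) by simp
    then obtain N where "\<forall>X \<in> carrier A.Fin. X \<in> conj_words A.Fin (carrier A.Fin) (A.cls g) N"
      using bounded by blast
    then have N: "\<exists>K. \<forall>\<epsilon>>0. \<forall>\<^sub>F n in \<U>. A.M.near n N K \<epsilon> (g n) (x n)" if "A.fin_seq x" for x
      using A.cls_in_conj_words_iff[OF g(1) that] A.cls_closed[OF that] by blast
    obtain \<sigma> t where \<sigma>: "\<sigma> > 0" "\<sigma> < \<infinity>" and ht: "\<forall>\<^sub>F n in \<U>. \<sigma> + \<sigma> \<le> nrm (h n) \<and> nrm (h n) \<le> of_nat t"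
      by (rule nontriv_seq_bounds[OF h(1,2)])
    obtain L \<rho> where "\<rho> > 0" and boot:
      "\<And>N S K. \<forall>\<^sub>F n in \<U>. \<forall>h \<in> A.shell \<sigma> (t + 1) n. \<forall>x \<in> carrier (G n).
          nrm' n x \<le> of_nat S \<longrightarrow> A.M.near n N K \<rho> h x \<Longrightarrow>
        \<exists>K. \<forall>\<epsilon>>0. \<forall>\<^sub>F n in \<U>. \<forall>h \<in> A.shell \<sigma> (t + 1) n. \<forall>x \<in> carrier (G n).
          nrm' n x \<le> of_nat S \<longrightarrow> A.M.near n (L + N) K \<epsilon> h x"
      by (rule A.near_bootstrap[OF words g \<sigma>(1)]) blast+
    \<comment> \<open>Now the length is fixed before X: it comes from the bound N for the one class
      of g, and only K may grow with the norm of x.\<close>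
    obtain L' where L': "\<And>S. \<exists>K. \<forall>\<^sub>F n in \<U>. \<forall>h \<in> A.shell \<sigma> (t + 1) n. \<forall>x \<in> carrier (G n).
        nrm' n x \<le> of_nat S \<longrightarrow> A.M.near n L' K \<rho> h x"
      using A.near_bounded[OF words g(1) N \<sigma>(1) \<open>\<rho> > 0\<close>] by blast
    have "X \<in> conj_words B.Fin (carrier B.Fin) Y (L + L')" if X: "X \<in> carrier B.Fin" for X
    proof -
      obtain x where x: "B.fin_seq x" "X = B.cls x" using X by (auto simp: B.carrier_Fin)
      obtain s :: nat where s: "\<forall>\<^sub>F n in \<U>. nrm (x n) \<le> of_nat s" using x(1) by (auto simp: B.fin_seq_def)
      obtain K where K: "\<forall>\<epsilon>>0. \<forall>\<^sub>F n in \<U>. \<forall>h \<in> A.shell \<sigma> (t + 1) n. \<forall>x \<in> carrier (G n).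
          nrm' n x \<le> of_nat (s + 1) \<longrightarrow> A.M.near n (L + L') K \<epsilon> h x"
        using L'[of "s + 1"] boot by blast
      show ?thesis
        unfolding x(2) h(3)
        by (rule cls_in_conj_wordsI[OF K[rule_format] \<sigma> h(1) x(1) ht s])
    qed
    then show ?thesis by blast
  qed
  then show ?thesis
    unfolding boundedly_simple_iff_conj_words using B.group_Fin by blast
qed

end

theorem theorem6p1:
  fixes G :: "nat \<Rightarrow> ('a, 'm) monoid_scheme" and nrm' :: "nat \<Rightarrow> 'a \<Rightarrow> ennreal"
    and H :: "('b, 'k) monoid_scheme" and nrm :: "'b \<Rightarrow> ennreal"
    and \<U> :: "nat filter"
  assumes "\<And>n. metric_group (G n) (nrm' n)"
    and "metric_group H nrm"
    and "nonprincipal_ultrafilter \<U>"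
    and "\<And>(t::real) (\<epsilon>::real) h\<^sub>1 h\<^sub>2.
          \<lbrakk>t > 0; \<epsilon> > 0; h\<^sub>1 \<in> carrier H; h\<^sub>2 \<in> carrier H;
            nrm h\<^sub>1 \<le> ennreal t; nrm h\<^sub>2 \<le> ennreal t\<rbrakk> \<Longrightarrow>
          \<forall>\<^sub>F n in \<U>. \<exists>g\<^sub>1 \<in> carrier (G n). \<exists>g\<^sub>2 \<in> carrier (G n). \<exists>\<phi> \<in> hom (G n) H.
            (\<forall>g \<in> carrier (G n). nrm (\<phi> g) = nrm' n g) \<and>
            nrm (\<phi> g\<^sub>1 \<otimes>\<^bsub>H\<^esub> inv\<^bsub>H\<^esub> h\<^sub>1) < ennreal \<epsilon> \<and>
            nrm (\<phi> g\<^sub>2 \<otimes>\<^bsub>H\<^esub> inv\<^bsub>H\<^esub> h\<^sub>2) < ennreal \<epsilon>"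
  shows "(is_simple_grp (met_ultraproduct_fin \<U> G nrm') \<longrightarrow>
            is_simple_grp (met_ultraproduct_fin \<U> (\<lambda>_. H) (\<lambda>_. nrm))) \<and>
         (boundedly_simple (met_ultraproduct_fin \<U> G nrm') \<longrightarrow>
            boundedly_simple (met_ultraproduct_fin \<U> (\<lambda>_. H) (\<lambda>_. nrm)))"
proof -
  interpret approximable_pairs \<U> G nrm' H nrm
    using assms
    by (intro approximable_pairs.intro metric_groups.intro approximable_pairs_axioms.intro) assumption+
  show ?thesis using simple_transfer boundedly_simple_transfer by blast
qed

end
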